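(* Let $N\ge1$. Assume $f\in C^0(\mathbb{R})\cap C^2((0,\infty))$ is nondecreasing and odd, that the restriction of $f$ to $(0,\infty)$ is convex and positive, and that the limit $q_0=\lim_{u\to0^+}q(u)$ exists in $\overline{\mathbb{R}}$. Let $p_0$ be the conjugate exponent of $q_0$. Let $u\in C^2(\mathbb{R}^N)$ be a bounded, stable solution (of arbitrary sign) of $-\Delta u=f(u)$ in $\mathbb{R}^N$. Then $u\equiv0$ if any of the following conditions holds: 1. $1\le N\le 9$ and $1<p_0$; 2. $N=10$ and $1<p_0<+\infty$; 3. $N\ge 11$ and $1<p_0<p_c(N)$.
   Context: For $u>0$, $q(u)=\dfrac{f'(u)^2}{f(u)f''(u)}$ if $f(u)f''(u)\ne0$, and $q(u)=+\infty$ otherwise. The conjugate exponent $p_0\in\overline{\mathbb{R}}$ of $q_0$ is defined by $1/p_0+1/q_0=1$, i.e. $p_0=q_0/(q_0-1)$ if $q_0\notin\{1,+\infty\}$, $p_0=+\infty$ if $q_0=1$, $p_0=1$ if $q_0=+\infty$. For $N\ge 11$, $p_c(N)=\dfrac{(N-2)^2-4N+8\sqrt{N-1}}{(N-2)(N-10)}$. A solution $u\in C^2(\mathbb{R}^N)$ of $-\Delta u=f(u)$ in $\mathbb{R}^N$ is stable if for all $\varphi\in C^1_c(\mathbb{R}^N)$, $\int_{\mathbb{R}^N} f'(u)\varphi^2\,dx\le\int_{\mathbb{R}^N}|\nabla\varphi|^2\,dx$. *)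

theory Defs
  imports "HOL-Analysis.Analysis"
begin

definition partial :: "'n::finite \<Rightarrow> (real ^ 'n \<Rightarrow> real) \<Rightarrow> real ^ 'n \<Rightarrow> real" where
  "partial i g x = frechet_derivative g (at x) (axis i 1)"

definition gradient :: "(real ^ 'n::finite \<Rightarrow> real) \<Rightarrow> real ^ 'n \<Rightarrow> real ^ 'n" where
  "gradient g x = (\<chi> i. partial i g x)"

definition laplacian :: "(real ^ 'n::finite \<Rightarrow> real) \<Rightarrow> real ^ 'n \<Rightarrow> real" where
  "laplacian g x = (\<Sum>i\<in>UNIV. partial i (partial i g) x)"

(* Differentiability is required explicitly, since frechet_derivative is
   unspecified at points where the function is not differentiable. *)
definition C1 :: "(real ^ 'n::finite \<Rightarrow> real) \<Rightarrow> bool" where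
  "C1 g \<longleftrightarrow> (\<forall>x. g differentiable (at x)) \<and> (\<forall>i. continuous_on UNIV (partial i g))"

definition C2 :: "(real ^ 'n::finite \<Rightarrow> real) \<Rightarrow> bool" where
  "C2 g \<longleftrightarrow> C1 g \<and> (\<forall>i. C1 (partial i g))"

definition C1_compact_support :: "(real ^ 'n::finite \<Rightarrow> real) \<Rightarrow> bool" where
  "C1_compact_support \<phi> \<longleftrightarrow> C1 \<phi> \<and> compact (closure {x. \<phi> x \<noteq> 0})"

definition C2_pos :: "(real \<Rightarrow> real) \<Rightarrow> bool" where
  "C2_pos f \<longleftrightarrow> f C1_differentiable_on {0<..} \<and> deriv f C1_differentiable_on {0<..}"

definition solution :: "(real \<Rightarrow> real) \<Rightarrow> (real ^ 'n::finite \<Rightarrow> real) \<Rightarrow> bool" where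
  "solution f u \<longleftrightarrow> C2 u \<and> (\<forall>x. - laplacian u x = f (u x))"

(* The nonlinearities f of interest are continuous and odd, and convex on (0, \<infinity>).
   Then f 0 = 0 and f is continuously differentiable on the whole line,
   including at 0, so that deriv f (u x) is meaningful where u vanishes or is negative, and both
   integrands are continuous with compact support. *)
definition stable :: "(real \<Rightarrow> real) \<Rightarrow> (real ^ 'n::finite \<Rightarrow> real) \<Rightarrow> bool" where
  "stable f u \<longleftrightarrow>
     (\<forall>\<phi>. C1_compact_support \<phi> \<longrightarrow>
        (\<integral>x. deriv f (u x) * (\<phi> x)\<^sup>2 \<partial>lborel) \<le> (\<integral>x. (norm (gradient \<phi> x))\<^sup>2 \<partial>lborel))"

definition q :: "(real \<Rightarrow> real) \<Rightarrow> real \<Rightarrow> ereal" where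
  "q f u = (if f u * deriv (deriv f) u \<noteq> 0
            then ereal ((deriv f u)\<^sup>2 / (f u * deriv (deriv f) u)) else \<infinity>)"

definition conjugate_exponent :: "ereal \<Rightarrow> ereal" where
  "conjugate_exponent q0 = (if q0 = 1 then \<infinity> else if q0 = \<infinity> then 1 else q0 / (q0 - 1))"

definition p_c :: "nat \<Rightarrow> real" where
  "p_c N = ((real N - 2)\<^sup>2 - 4 * real N + 8 * sqrt (real N - 1)) / ((real N - 2) * (real N - 10))"

end

(* Stability is tested with phi(u) zeta and the equation with psi(u) zeta^2, where psi' = phi'^2
   and phi(0) = psi(0) = 0. Near 0, phi behaves like f^(1 + b); away from 0, phi is a constant
   multiple of f. The inequality b^2 < 1 / q0 makes f psi <= (1 - d) f' phi^2 near 0, and convexity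
   propagates this to the whole bounded range of u, because (f' phi^2 - f psi) / f is nondecreasing
   wherever phi is a multiple of f. Hence the integral of f'(u) phi(u)^2 zeta^2 is bounded by a
   multiple of that of phi(u)^2 |grad zeta|^2. Since f' >= c f^kap with kap slightly above 1 / q0,
   a cutoff zeta at scale R bounds the former by R^(N - 2 g), g = 1 + 2 (1 + b) / kap. As b tends
   to 1 / sqrt q0 and kap to 1 / q0, the condition N < 2 g becomes N < 2 + 4 (q0 + sqrt q0), which
   the hypotheses on N and p0 guarantee. *)

theory Submission
  imports Defs
begin

text \<open>For t > 0, divide f psi <= (1 - d) f' phi^2 by f and differentiate. With phi = f^(1 + b)
  and d = 0 this becomes b^2 <= f f'' / f'^2, whose right-hand side is 1 / q. That is the origin of
  the condition on b, and also the obstacle: q is controlled only near 0, while elsewhere convexity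
  gives just f f'' >= 0, which tolerates b = 0 without any margin. So phi must lose its excess
  exponent, keeping phi' continuous, before the control of q ends. The margin won near 0 survives as
  an absolute amount, and boundedness of u turns it into a proportion. The two bounds on f f'' /
  f'^2 have different roles: the lower one, lam, limits b; the upper one, kap, limits how degenerate
  f' can be. The decay rate is a pointwise count with w = |f(u)|. Where c w^kap dominates R^(-2),
  the gradient term is absorbed. Elsewhere w is at most of order R^(-2 / kap), so phi^2 |grad
  zeta|^2 is at most of order R^(-2) R^(-4 (1 + b) / kap) = R^(-2 g). Since phi and psi are odd and
  f' is even, the sign of u never matters.\<close>

section \<open>Odd convex nonlinearities\<close>

text \<open>Both \<open>f'\<close> and \<open>\<phi>'\<close> are understood first on the positive
  axis. Evenness carries continuity to the negative axis and reduces continuity at 0 to a right-hand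
  limit.\<close>

lemma even_isCont:
  fixes g :: "real \<Rightarrow> real"
  assumes even: "\<And>t. g (- t) = g t" and pos: "\<And>t. t > 0 \<Longrightarrow> isCont g t"
    and zero: "(g \<longlongrightarrow> g 0) (at_right 0)"
  shows "isCont g t"
proof -
  consider "t < 0" | "t = 0" | "t > 0" by linarith
  then show ?thesis
  proof cases
    case 1
    have "isCont (\<lambda>t. g (- t)) t"
      by (rule isCont_o2[where f = uminus]) (use 1 pos in auto)
    then show ?thesis by (simp add: even)
  next
    case 2
    have "(g \<longlongrightarrow> g 0) (at_left 0)"
      using zero by (simp add: at_left_minus filterlim_filtermap even)
    with zero show ?thesis using 2 by (simp add: isCont_def filterlim_split_at)
  qed (use pos in auto)
qed

locale odd_convex_nonlinearity =
  fixes f :: "real \<Rightarrow> real"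
  assumes cont: "continuous_on UNIV f"
    and C2: "C2_pos f"
    and odd: "\<And>t. f (- t) = - f t"
    and conv: "convex_on {0<..} f"
    and pos: "\<And>t. t > 0 \<Longrightarrow> f t > 0"
begin

abbreviation f' :: "real \<Rightarrow> real" where "f' \<equiv> deriv f"
abbreviation f'' :: "real \<Rightarrow> real" where "f'' \<equiv> deriv (deriv f)"

lemma f_0 [simp]: "f 0 = 0"
  using odd[of 0] by simp

lemma abs_f: "\<bar>f t\<bar> = f \<bar>t\<bar>"
  using odd[of t] pos[of t] pos[of "-t"] by (cases t "0::real" rule: linorder_cases) auto

lemma f_nonneg: "t \<ge> 0 \<Longrightarrow> f t \<ge> 0"
  using pos[of t] by (cases "t = 0") auto

lemma f_has_derivative: "(f has_real_derivative f' t) (at t)" if "t > 0"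
  using C2 that unfolding C2_pos_def C1_differentiable_on_def has_real_derivative_iff_has_vector_derivative[symmetric]
  by (metis DERIV_imp_deriv greaterThan_iff)

lemma f'_has_derivative: "(f' has_real_derivative f'' t) (at t)" if "t > 0"
  using C2 that unfolding C2_pos_def C1_differentiable_on_def has_real_derivative_iff_has_vector_derivative[symmetric]
  by (metis DERIV_imp_deriv greaterThan_iff)

lemma isCont_f: "isCont f t"
  using cont by (simp add: continuous_on_eq_continuous_at)

lemma isCont_f'_pos: "isCont f' t" if "t > 0"
  using f'_has_derivative[OF that] by (rule DERIV_isCont)

lemma f'_mono: "f' s \<le> f' t" if "0 < s" "s \<le> t"
proof (cases "s = t")
  case False
  \<comment> \<open>Adding the tangent inequalities at s and at t cancels the values of f.\<close>
  have tan: "f x - f c \<ge> f' c * (x - c)" if "c > 0" "x > 0" for x c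
    by (rule convex_on_imp_above_tangent[OF conv])
      (use that f_has_derivative[of c] in \<open>auto simp: interior_open has_field_derivative_at_within\<close>)
  have "f' s * (t - s) \<le> f' t * (t - s)"
    using tan[of s t] tan[of t s] that by (simp add: algebra_simps)
  then show ?thesis using False that by simp
qed simp

lemma f''_nonneg: "f'' t \<ge> 0" if "t > 0"
  by (rule mono_on_imp_deriv_nonneg[of "{0<..}" f' _ t])
    (use that f'_has_derivative[of t] f'_mono in \<open>auto simp: mono_on_def interior_open\<close>)

text \<open>Mean value theorem on [0, t] with f 0 = 0: the slope at an inner point is at most
  \<open>f' t\<close>. This yields \<open>f' t > 0\<close> and later squeezes \<open>f h / h\<close>
  at 0.\<close>

lemma f_le_mult_f': "f t \<le> t * f' t" if t: "0 < t"
proof -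
  have "continuous_on {0..t} f"
    using cont continuous_on_subset by blast
  moreover have "f differentiable (at x)" if "0 < x" for x
    using f_has_derivative[OF that] by (auto simp: real_differentiable_def)
  ultimately obtain l z where z: "0 < z" "z < t" "(f has_real_derivative l) (at z)" "f t - f 0 = (t - 0) * l"
    using MVT[OF t, of f] by metis
  then have "l = f' z" using DERIV_imp_deriv by metis
  then show ?thesis using z f'_mono[of z t] that by simp
qed

lemma f'_pos: "f' t > 0" if "t > 0"
  using f_le_mult_f'[OF that] pos[OF that] that by (smt (verit) zero_less_mult_iff)

lemma f_mono: "f s \<le> f t" if "0 \<le> s" "s \<le> t"
proof (rule DERIV_nonneg_imp_increasing_open[OF that(2)])
  show "\<exists>y. (f has_real_derivative y) (at x) \<and> y \<ge> 0" if "s < x" for x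
    using f_has_derivative[of x] f'_pos[of x] that \<open>0 \<le> s\<close> less_imp_le[of 0 "f' x"] by auto
qed (rule continuous_on_subset[OF cont], simp)

end

section \<open>Two-sided power bounds on f' near 0, and regularity at 0\<close>

locale asymptotically_power = odd_convex_nonlinearity +
  fixes lam kap t0 :: real
  assumes lam: "0 < lam" and lam_kap: "lam \<le> kap" and t0: "t0 > 0"
    and lower: "\<And>t. 0 < t \<Longrightarrow> t \<le> t0 \<Longrightarrow> lam * (f' t)\<^sup>2 \<le> f t * f'' t"
    and upper: "\<And>t. 0 < t \<Longrightarrow> t \<le> t0 \<Longrightarrow> f t * f'' t \<le> kap * (f' t)\<^sup>2"
begin

text \<open>The sign of f f'' - a f'^2 decides the monotonicity of f' / f^a. On (0, t0] the quotient
  is therefore nondecreasing for a = lam and nonincreasing for a = kap. For the model f = t^p the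
  ratio f f'' / f'^2 is the constant (p - 1) / p.\<close>

lemma ratio_has_derivative:
  "((\<lambda>t. f' t * f t powr (- a)) has_real_derivative f t powr (- a - 1) * (f t * f'' t - a * (f' t)\<^sup>2)) (at t)"
  if "t > 0"
proof -
  have "f t powr (- a) = f t powr (- a - 1) * f t"
    using pos[OF that] by (simp add: powr_diff)
  then show ?thesis
    using pos[OF that]
    by (intro DERIV_cong[OF DERIV_mult[OF f'_has_derivative[OF that] DERIV_fun_powr[OF f_has_derivative[OF that]]]])
      (simp_all add: power2_eq_square algebra_simps)
qed

lemma f'_le: "f' t \<le> f' t0 * f t0 powr (- lam) * f t powr lam" if "0 < t" "t \<le> t0"
proof -
  have "f' t * f t powr (- lam) \<le> f' t0 * f t0 powr (- lam)"
  proof (rule DERIV_nonneg_imp_nondecreasing[OF that(2)])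
    fix x assume "t \<le> x" "x \<le> t0"
    then show "\<exists>y. ((\<lambda>t. f' t * f t powr - lam) has_real_derivative y) (at x) \<and> 0 \<le> y"
      using that lower[of x]
      by (intro exI[of _ "f x powr (- lam - 1) * (f x * f'' x - lam * (f' x)\<^sup>2)"] conjI ratio_has_derivative mult_nonneg_nonneg) auto
  qed
  from mult_right_mono[OF this, of "f t powr lam"] show ?thesis
    using pos[OF that(1)] by (simp add: powr_minus field_simps)
qed

lemma f'_ge: "f' t \<ge> f' t0 * f t0 powr (- kap) * f t powr kap" if "0 < t" "t \<le> t0"
proof -
  have "f' t * f t powr (- kap) \<ge> f' t0 * f t0 powr (- kap)"
  proof (rule DERIV_nonpos_imp_nonincreasing[OF that(2)])
    fix x assume "t \<le> x" "x \<le> t0"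
    then show "\<exists>y. ((\<lambda>t. f' t * f t powr - kap) has_real_derivative y) (at x) \<and> y \<le> 0"
      using that upper[of x]
      by (intro exI[of _ "f x powr (- kap - 1) * (f x * f'' x - kap * (f' x)\<^sup>2)"] conjI ratio_has_derivative mult_nonneg_nonpos) auto
  qed
  from mult_right_mono[OF this, of "f t powr kap"] show ?thesis
    using pos[OF that(1)] by (simp add: powr_minus field_simps)
qed

lemma f'_tendsto_0_right: "(f' \<longlongrightarrow> 0) (at_right 0)"
proof (rule tendsto_sandwich)
  show "\<forall>\<^sub>F t in at_right 0. 0 \<le> f' t"
    using f'_pos by (auto simp: eventually_at_filter less_imp_le)
  show "\<forall>\<^sub>F t in at_right 0. f' t \<le> f' t0 * f t0 powr (- lam) * f t powr lam"
    using f'_le eventually_at_right_less[of 0] eventually_at_right_real[OF t0]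
    by (auto elim!: eventually_mono)
  have "((\<lambda>t. f t powr lam) \<longlongrightarrow> 0) (at_right 0)"
  proof (rule tendsto_zero_powrI)
    show "(f \<longlongrightarrow> 0) (at_right 0)"
      using isCont_f[of 0] by (auto simp: isCont_def filterlim_at_split)
    show "\<forall>\<^sub>F x in at_right 0. 0 \<le> f x"
      using f_nonneg by (auto simp: eventually_at_filter less_imp_le)
  qed (use lam in auto)
  then show "((\<lambda>t. f' t0 * f t0 powr (- lam) * f t powr lam) \<longlongrightarrow> 0) (at_right 0)"
    using tendsto_mult_right_zero by blast
qed auto

text \<open>The right-hand quotient lies between 0 and \<open>f' h\<close>, which tends to 0 because
  \<open>lam > 0\<close>; oddness gives the left-hand one. Hence \<open>deriv f\<close> is a genuine
  derivative also at the zeros of u.\<close>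

lemma f_has_derivative_0: "(f has_real_derivative 0) (at 0)"
proof -
  have r: "((\<lambda>h. f h / h) \<longlongrightarrow> 0) (at_right 0)"
  proof (rule tendsto_sandwich[OF _ _ _ f'_tendsto_0_right])
    show "\<forall>\<^sub>F h in at_right 0. 0 \<le> f h / h"
      using f_nonneg by (auto simp: eventually_at_filter less_imp_le)
    show "\<forall>\<^sub>F h in at_right 0. f h / h \<le> f' h"
      using f_le_mult_f' by (auto simp: eventually_at_filter field_simps)
  qed auto
  then have "((\<lambda>h. f h / h) \<longlongrightarrow> 0) (at_left 0)"
    by (simp add: at_left_minus filterlim_filtermap odd)
  with r show ?thesis
    by (simp add: has_field_derivative_iff filterlim_split_at)
qed

lemma f'_0 [simp]: "f' 0 = 0"
  using f_has_derivative_0 by (rule DERIV_imp_deriv)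

lemma f'_minus: "f' (- t) = f' t"
proof -
  have eq: "f' (- t) = f' t" if "t < 0" for t
  proof -
    have "((\<lambda>t. - f (- t)) has_real_derivative f' (- t)) (at t)"
      using DERIV_minus[OF DERIV_mirror[THEN iffD1, OF f_has_derivative[of "- t"]]] that by simp
    then have "(f has_real_derivative f' (- t)) (at t)" by (simp add: odd)
    from DERIV_imp_deriv[OF this] show ?thesis by simp
  qed
  show "f' (- t) = f' t"
    using eq[of t] eq[of "- t"] by (cases t "0 :: real" rule: linorder_cases) auto
qed

lemma f'_abs: "f' \<bar>t\<bar> = f' t"
  using f'_minus[of t] by (simp add: abs_if)

lemma f'_nonneg: "f' t \<ge> 0"
  using f'_pos[of "\<bar>t\<bar>"] by (cases "t = 0") (auto simp: f'_abs)

lemma isCont_f': "isCont f' t"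
  by (rule even_isCont) (use f'_minus isCont_f'_pos f'_tendsto_0_right in auto)

text \<open>Beyond t0, \<open>f'\<close> stays above \<open>f' t0\<close> and f stays below
  \<open>f M\<close>, so a smaller constant extends the bound from (0, t0] to the range of u. It
  turns smallness of \<open>f' (u x)\<close> into smallness of \<open>f (u x)\<close>.\<close>

lemma f'_ge_power:
  assumes "M > 0"
  obtains c where "c > 0" "\<And>t. \<bar>t\<bar> \<le> M \<Longrightarrow> f' t \<ge> c * \<bar>f t\<bar> powr kap"
proof -
  define c where "c = min (f' t0 * f t0 powr (- kap)) (f' t0 / f M powr kap)"
  have c: "c > 0" using f'_pos[OF t0] pos[OF t0] pos[OF assms] by (simp add: c_def)
  have 1: "f' t \<ge> c * f t powr kap" if "0 < t" "t \<le> M" for t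
  proof (cases "t \<le> t0")
    case True
    have "c * f t powr kap \<le> (f' t0 * f t0 powr (- kap)) * f t powr kap"
      by (intro mult_right_mono) (auto simp: c_def)
    then show ?thesis using f'_ge[OF that(1) True] by simp
  next
    case False
    have "c * f t powr kap \<le> (f' t0 / f M powr kap) * f M powr kap"
      using that pos[OF that(1)] f_mono[of t M] lam lam_kap f'_pos[OF t0] 
      by (intro mult_mono powr_mono2) (auto simp: c_def)
    also have "\<dots> = f' t0" using pos[OF assms] by simp
    also have "\<dots> \<le> f' t" using f'_mono[of t0 t] t0 False by simp
    finally show ?thesis .
  qed
  have "f' t \<ge> c * \<bar>f t\<bar> powr kap" if "\<bar>t\<bar> \<le> M" for t
    using 1[of "\<bar>t\<bar>"] that by (cases "t = 0") (auto simp: f'_abs abs_f)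
  with c that show ?thesis by blast
qed

end

section \<open>The truncated power of the nonlinearity\<close>

text \<open>An exponent of at least 2 flattens the kink of the positive part. This serves both the
  truncation of \<open>\<phi>\<close> and the spatial cutoff.\<close>

lemma max_zero_power_has_derivative:
  fixes y :: real
  shows "((\<lambda>y. max 0 y ^ Suc (Suc k)) has_real_derivative real (Suc (Suc k)) * max 0 y ^ Suc k) (at y)"
proof -
  consider "y < 0" | "y = 0" | "y > 0" by linarith
  then show ?thesis
  proof cases
    case 1
    have "((\<lambda>y. 0 :: real) has_real_derivative real (Suc (Suc k)) * max 0 y ^ Suc k) (at y)"
      using 1 by simp
    then show ?thesis
      by (rule has_field_derivative_transform_within_open[of _ _ _ "{..<0}"]) (use 1 in auto)
  next
    case 2
    have "((\<lambda>h::real. max 0 h ^ Suc k) \<longlongrightarrow> max 0 0 ^ Suc k) (at 0)"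
      by (intro tendsto_intros)
    moreover have "max 0 h ^ Suc (Suc k) / h = max 0 h ^ Suc k" if "h \<noteq> 0" for h :: real
      using that by (auto simp: max_def)
    ultimately have "((\<lambda>h::real. max 0 h ^ Suc (Suc k) / h) \<longlongrightarrow> 0) (at 0)"
      by (subst Lim_cong_within[where g = "\<lambda>h. max 0 h ^ Suc k"]) auto
    then show ?thesis using 2 by (simp add: has_field_derivative_iff)
  next
    case 3
    have "((\<lambda>y. y ^ Suc (Suc k)) has_real_derivative real (Suc (Suc k)) * max 0 y ^ Suc k) (at y)"
      by (rule derivative_eq_intros refl | use 3 in simp)+
    then show ?thesis
      by (rule has_field_derivative_transform_within_open[of _ _ _ "{0<..}"]) (use 3 in auto)
  qed
qed

text \<open>With x = \<open>s / s\<^sub>0\<close> the base is x (2 - x) for 0 <= x <= 1 and 1 for x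
  >= 1. So the function is comparable to s^b near 0 and constant from \<open>s\<^sub>0\<close> on,
  and the square makes the slopes match where the pieces meet.\<close>

definition cutoff_power :: "real \<Rightarrow> real \<Rightarrow> real \<Rightarrow> real" where
  "cutoff_power s\<^sub>0 b s = (1 - (max 0 (1 - s / s\<^sub>0))\<^sup>2) powr b"

(* The logarithmic slope s m'(s) / m(s) of m = cutoff_power: it decreases from b to 0 on (0, s0]. *)
definition cutoff_slope :: "real \<Rightarrow> real \<Rightarrow> real \<Rightarrow> real" where
  "cutoff_slope s\<^sub>0 b s =
     b * (2 * (s / s\<^sub>0) * max 0 (1 - s / s\<^sub>0)) / (1 - (max 0 (1 - s / s\<^sub>0))\<^sup>2)"

context
  fixes s\<^sub>0 b :: real
  assumes s\<^sub>0: "s\<^sub>0 > 0" and b: "b > 0"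
begin

lemma cutoff_base_pos: "1 - (max 0 (1 - s / s\<^sub>0))\<^sup>2 > 0" if "s > 0"
proof -
  have "(max 0 (1 - s / s\<^sub>0))\<^sup>2 < 1"
    using that s\<^sub>0 by (simp add: abs_square_less_1 max_def)
  then show ?thesis by simp
qed

lemma cutoff_base_nonneg: "1 - (max 0 (1 - s / s\<^sub>0))\<^sup>2 \<ge> 0" if "s \<ge> 0"
  using cutoff_base_pos[of s] that by (cases "s = 0") auto

lemma cutoff_power_0 [simp]: "cutoff_power s\<^sub>0 b 0 = 0"
  by (simp add: cutoff_power_def)

lemma cutoff_power_pos: "cutoff_power s\<^sub>0 b s > 0" if "s > 0"
  using cutoff_base_pos[OF that] by (simp add: cutoff_power_def)

lemma cutoff_power_le: "cutoff_power s\<^sub>0 b s \<le> (2 / s\<^sub>0) powr b * s powr b" if "s \<ge> 0"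
proof -
  have "1 - (max 0 (1 - s / s\<^sub>0))\<^sup>2 \<le> 2 / s\<^sub>0 * s"
    using s\<^sub>0 that by (auto simp: max_def power2_eq_square field_simps)
  then have "cutoff_power s\<^sub>0 b s \<le> (2 / s\<^sub>0 * s) powr b"
    unfolding cutoff_power_def using cutoff_base_nonneg[OF that] b by (intro powr_mono2) auto
  then show ?thesis
    using s\<^sub>0 that by (simp add: powr_mult powr_divide)
qed

lemma continuous_on_cutoff_power: "continuous_on {0..} (cutoff_power s\<^sub>0 b)"
  unfolding cutoff_power_def using cutoff_base_nonneg b s\<^sub>0
  by (intro continuous_on_powr' continuous_intros) auto

lemma cutoff_slope_nonneg: "cutoff_slope s\<^sub>0 b s \<ge> 0" if "s \<ge> 0"
  unfolding cutoff_slope_def using cutoff_base_nonneg[OF that] b s\<^sub>0 that by (intro divide_nonneg_nonneg mult_nonneg_nonneg) auto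

lemma cutoff_slope_le: "cutoff_slope s\<^sub>0 b s \<le> b" if "s > 0"
proof -
  \<comment> \<open>For x < 1 this compares 2 x (1 - x) with x (2 - x); the difference is
    x^2.\<close>
  have "2 * x * max 0 (1 - x) \<le> 1 - (max 0 (1 - x))\<^sup>2" if "x > 0" for x :: real
    using that by (auto simp: max_def power2_eq_square algebra_simps)
  from this[of "s / s\<^sub>0"]
  have "2 * (s / s\<^sub>0) * max 0 (1 - s / s\<^sub>0) \<le> 1 - (max 0 (1 - s / s\<^sub>0))\<^sup>2"
    using s\<^sub>0 that by simp
  then have "2 * (s / s\<^sub>0) * max 0 (1 - s / s\<^sub>0) / (1 - (max 0 (1 - s / s\<^sub>0))\<^sup>2) \<le> 1"
    using cutoff_base_pos[OF that] by (simp only: divide_le_eq_1_pos)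
  from mult_left_mono[OF this, of b] show ?thesis
    using b by (simp add: cutoff_slope_def)
qed

lemma cutoff_slope_eq_0: "cutoff_slope s\<^sub>0 b s = 0" if "s \<ge> s\<^sub>0"
  using that s\<^sub>0 by (simp add: cutoff_slope_def max_def field_simps)

lemma continuous_on_cutoff_slope: "continuous_on {0<..} (cutoff_slope s\<^sub>0 b)"
  unfolding cutoff_slope_def using cutoff_base_pos s\<^sub>0
  by (intro continuous_intros) (auto simp: less_imp_neq[symmetric])

lemma cutoff_power_has_derivative:
  "(cutoff_power s\<^sub>0 b has_real_derivative cutoff_slope s\<^sub>0 b s * cutoff_power s\<^sub>0 b s / s) (at s)" if "s > 0"
proof -
  define y where "y = max 0 (1 - s / s\<^sub>0)"
  have y: "1 - y\<^sup>2 > 0" using cutoff_base_pos[OF that] by (simp add: y_def)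
  have d: "((\<lambda>s. 1 - s / s\<^sub>0) has_real_derivative - (1 / s\<^sub>0)) (at s)"
    using s\<^sub>0 by (auto intro!: derivative_eq_intros)
  have "((\<lambda>s. (max 0 (1 - s / s\<^sub>0))\<^sup>2) has_real_derivative 2 * y * (- (1 / s\<^sub>0))) (at s)"
    using DERIV_chain2[OF max_zero_power_has_derivative[of 0] d] by (simp add: numeral_2_eq_2 y_def)
  from DERIV_diff[OF DERIV_const this]
  have "((\<lambda>s. 1 - (max 0 (1 - s / s\<^sub>0))\<^sup>2) has_real_derivative 2 * y / s\<^sub>0) (at s)"
    by simp
  from DERIV_fun_powr[OF this, of b]
  have "(cutoff_power s\<^sub>0 b has_real_derivative b * (1 - y\<^sup>2) powr (b - 1) * (2 * y / s\<^sub>0)) (at s)"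
    using y by (simp add: y_def cutoff_power_def[abs_def])
  moreover have "b * (1 - y\<^sup>2) powr (b - 1) * (2 * y / s\<^sub>0) = cutoff_slope s\<^sub>0 b s * cutoff_power s\<^sub>0 b s / s"
    using y that s\<^sub>0 by (simp add: cutoff_slope_def cutoff_power_def y_def[symmetric] powr_diff ac_simps)
  ultimately show ?thesis by simp
qed

end

section \<open>The truncated test function \<open>\<phi>\<close>\<close>

locale test_function = asymptotically_power +
  fixes b :: real
  assumes b: "0 < b" "b \<le> 1" and b2: "b\<^sup>2 < lam"
begin

text \<open>Truncating in the variable f |t| instead of t gives \<mu>' = \<sigma> \<mu> f' / f for t
  > 0, so that \<open>\<phi>\<close> has logarithmic derivative (1 + \<sigma>) f' / f. The later
  comparisons then involve only f f'', f'^2 and \<sigma>. Taking \<open>f t0\<close> as threshold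
  makes \<sigma> vanish from t0 on.\<close>

definition "\<mu> t = cutoff_power (f t0) b (f \<bar>t\<bar>)"
definition "\<sigma> t = cutoff_slope (f t0) b (f \<bar>t\<bar>)"
definition "\<phi> t = f t * \<mu> t"
definition "\<phi>' t = (1 + \<sigma> t) * \<mu> t * f' t"

lemmas s0 = pos[OF t0]

lemma \<mu>_0 [simp]: "\<mu> 0 = 0"
  using s0 b by (simp add: \<mu>_def)

lemma \<mu>_pos: "\<mu> t > 0" if "t \<noteq> 0"
  using that cutoff_power_pos[OF s0 b(1) pos[of "\<bar>t\<bar>"]] by (simp add: \<mu>_def)

lemma \<mu>_nonneg: "\<mu> t \<ge> 0"
  using \<mu>_pos[of t] by (cases "t = 0") auto

lemma \<mu>_minus: "\<mu> (- t) = \<mu> t" and \<sigma>_minus: "\<sigma> (- t) = \<sigma> t"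
  by (simp_all add: \<mu>_def \<sigma>_def)

lemma \<sigma>_nonneg: "\<sigma> t \<ge> 0"
  using cutoff_slope_nonneg[OF s0 b(1)] f_nonneg[of "\<bar>t\<bar>"] by (simp add: \<sigma>_def)

lemma \<sigma>_le: "\<sigma> t \<le> b"
proof (cases "t = 0")
  case True
  then show ?thesis using b by (simp add: \<sigma>_def cutoff_slope_def)
next
  case False
  then show ?thesis using cutoff_slope_le[OF s0 b(1) pos[of "\<bar>t\<bar>"]] by (simp add: \<sigma>_def)
qed

lemma \<sigma>_eq_0: "\<sigma> t = 0" if "t \<ge> t0"
  using cutoff_slope_eq_0[OF s0 b(1)] f_mono[of t0 t] that t0 by (simp add: \<sigma>_def)

lemma \<phi>_bound: "\<bar>\<phi> t\<bar> \<le> (2 / f t0) powr b * \<bar>f t\<bar> powr (1 + b)"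
proof -
  have "\<mu> t \<le> (2 / f t0) powr b * \<bar>f t\<bar> powr b"
    using cutoff_power_le[OF s0 b(1) f_nonneg[of "\<bar>t\<bar>"]] by (simp add: \<mu>_def abs_f)
  from mult_left_mono[OF this, of "\<bar>f t\<bar>"]
  have "\<bar>f t\<bar> * \<mu> t \<le> (2 / f t0) powr b * (\<bar>f t\<bar> * \<bar>f t\<bar> powr b)"
    by (simp only: abs_ge_zero mult.left_commute simp_thms)
  then show ?thesis
    unfolding \<phi>_def abs_mult abs_of_nonneg[OF \<mu>_nonneg] powr_add powr_one[OF abs_ge_zero] .
qed

lemma isCont_\<mu>: "isCont \<mu> t"
proof -
  have "continuous_on UNIV (\<lambda>t. cutoff_power (f t0) b (f \<bar>t\<bar>))"
  proof (rule continuous_on_compose2[OF continuous_on_cutoff_power[OF s0 b(1)]])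
    show "continuous_on UNIV (\<lambda>t. f \<bar>t\<bar>)"
      by (rule continuous_on_compose2[OF cont]) (auto intro: continuous_intros)
    show "(\<lambda>t. f \<bar>t\<bar>) ` UNIV \<subseteq> {0..}"
      by (simp add: image_subset_iff f_nonneg)
  qed
  then show ?thesis
    unfolding \<mu>_def[abs_def] continuous_on_eq_continuous_at[OF open_UNIV] by blast
qed

lemma \<mu>_has_derivative:
  "(\<mu> has_real_derivative \<sigma> t * \<mu> t / f t * f' t) (at t)" if "t > 0"
proof -
  have "((\<lambda>t. cutoff_power (f t0) b (f t)) has_real_derivative \<sigma> t * \<mu> t / f t * f' t) (at t)"
    unfolding \<mu>_def \<sigma>_def abs_of_pos[OF that]
    by (rule DERIV_chain2[OF cutoff_power_has_derivative[OF s0 b(1) pos[OF that]] f_has_derivative[OF that]])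
  then show ?thesis
    by (rule has_field_derivative_transform_within_open[of _ _ _ "{0<..}"]) (use that in \<open>auto simp: \<mu>_def\<close>)
qed

lemma \<phi>_minus: "\<phi> (- t) = - \<phi> t"
  by (simp add: \<phi>_def odd \<mu>_minus)

lemma \<phi>'_minus: "\<phi>' (- t) = \<phi>' t"
  by (simp add: \<phi>'_def \<mu>_minus \<sigma>_minus f'_minus)

lemma \<phi>'_nonneg: "\<phi>' t \<ge> 0"
  unfolding \<phi>'_def by (intro mult_nonneg_nonneg add_nonneg_nonneg \<sigma>_nonneg \<mu>_nonneg f'_nonneg) simp

lemma \<phi>_has_derivative: "(\<phi> has_real_derivative \<phi>' t) (at t)"
proof -
  have p: "(\<phi> has_real_derivative \<phi>' t) (at t)" if "t > 0" for t
    unfolding \<phi>_def[abs_def]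
    by (rule DERIV_cong[OF DERIV_mult[OF f_has_derivative[OF that] \<mu>_has_derivative[OF that]]])
      (use pos[OF that] in \<open>simp add: \<phi>'_def field_simps\<close>)
  consider "t < 0" | "t = 0" | "t > 0" by linarith
  then show ?thesis
  proof cases
    case 1
    have "((\<lambda>t. - \<phi> (- t)) has_real_derivative \<phi>' t) (at t)"
      using DERIV_minus[OF DERIV_mirror[THEN iffD1, OF p[of "- t"]]] 1 by (simp add: \<phi>'_minus)
    then show ?thesis by (simp add: \<phi>_minus)
  next
    case 2
    have "((\<lambda>h. f h / h * \<mu> h) \<longlongrightarrow> 0 * 0) (at 0)"
      using f_has_derivative_0 isCont_\<mu>[of 0] by (intro tendsto_mult) (auto simp: has_field_derivative_iff isCont_def)
    then show ?thesis using 2 by (simp add: has_field_derivative_iff \<phi>_def \<phi>'_def)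
  qed (use p in auto)
qed

lemma isCont_\<phi>': "isCont \<phi>' t"
proof (rule even_isCont[where g = \<phi>'])
  show "\<phi>' (- t) = \<phi>' t" for t
    by (rule \<phi>'_minus)
next
  fix t :: real assume t: "t > 0"
  have "isCont (cutoff_slope (f t0) b) (f \<bar>t\<bar>)"
    using continuous_on_cutoff_slope[OF s0 b(1)] pos[of t] t
    by (simp add: continuous_on_eq_continuous_at)
  moreover have "isCont (\<lambda>t. f \<bar>t\<bar>) t"
    by (rule isCont_o2[OF _ isCont_f]) (rule continuous_intros)+
  ultimately have "isCont \<sigma> t"
    unfolding \<sigma>_def[abs_def] by (rule isCont_o2[rotated])
  then show "isCont \<phi>' t"
    unfolding \<phi>'_def[abs_def] by (intro continuous_intros isCont_f' isCont_\<mu>)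
next
  have "(\<phi>' \<longlongrightarrow> 0) (at_right 0)"
  \<comment> \<open>\<open>\<sigma>\<close> is not continuous at 0: its value there is 0, its limit
    is b. Only its bound enters, since \<mu> and f' both vanish at 0.\<close>
  proof (rule tendsto_sandwich[where f = "\<lambda>_. 0" and h = "\<lambda>t. 2 * \<mu> t * f' t"])
    have "(\<lambda>t. 2 * \<mu> t * f' t) \<midarrow>0\<rightarrow> 2 * 0 * 0"
      using isCont_\<mu>[of 0] isCont_f'[of 0] by (intro tendsto_intros) (auto simp: isCont_def)
    then show "((\<lambda>t. 2 * \<mu> t * f' t) \<longlongrightarrow> 0) (at_right 0)"
      by (simp add: filterlim_at_split)
    have "1 + \<sigma> t \<le> 2" for t using \<sigma>_le[of t] b by simp
    then have "\<phi>' t \<le> 2 * \<mu> t * f' t" for t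
      unfolding \<phi>'_def by (intro mult_right_mono \<mu>_nonneg f'_nonneg)
    then show "\<forall>\<^sub>F t in at_right 0. \<phi>' t \<le> 2 * \<mu> t * f' t" by simp
  qed (use \<phi>'_nonneg in auto)
  then show "(\<phi>' \<longlongrightarrow> \<phi>' 0) (at_right 0)" by (simp add: \<phi>'_def)
qed

section \<open>The primitive \<open>\<psi>\<close> and its comparison with f' \<phi>^2 / f\<close>

lemma primitive_exists:
  "\<exists>\<psi>. (\<forall>t. (\<psi> has_real_derivative (\<phi>' t)\<^sup>2) (at t)) \<and> \<psi> 0 = 0 \<and> (\<forall>t. \<psi> (- t) = - \<psi> t)"
proof -
  have "\<And>t. isCont (\<lambda>t. (\<phi>' t)\<^sup>2) t"
    by (intro continuous_intros isCont_\<phi>')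
  then obtain F where F: "\<And>t. (F has_real_derivative (\<phi>' t)\<^sup>2) (at t)"
    using einterval_antiderivative[of "- \<infinity>" "\<infinity>" "\<lambda>t. (\<phi>' t)\<^sup>2"]
    by (auto simp: has_real_derivative_iff_has_vector_derivative)
  define \<psi> where "\<psi> t = F t - F 0" for t
  have D: "(\<psi> has_real_derivative (\<phi>' t)\<^sup>2) (at t)" for t
    unfolding \<psi>_def using F by (auto intro!: derivative_eq_intros)
  \<comment> \<open>Oddness of the primitive comes from evenness of \<open>\<phi>'\<close>.\<close>
  have "((\<lambda>t. \<psi> t + \<psi> (- t)) has_real_derivative 0) (at t)" for t
    using DERIV_add[OF D[of t] DERIV_mirror[THEN iffD1, OF D[of "- t"]]] by (simp add: \<phi>'_minus)
  then have "\<psi> t + \<psi> (- t) = \<psi> 0 + \<psi> (- 0)" for t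
    by (intro DERIV_isconst_all) auto
  then have "\<psi> (- t) = - \<psi> t" for t
    using \<psi>_def[of 0] by (smt (verit))
  moreover have "\<psi> 0 = 0" by (simp add: \<psi>_def)
  ultimately show ?thesis using D by blast
qed

text \<open>This is the integral of \<open>\<phi>'\<close> squared from 0 to t. Fixing it by its
  derivative and its value at 0 treats both signs of t alike.\<close>

definition "\<psi> = (SOME \<psi>. (\<forall>t. (\<psi> has_real_derivative (\<phi>' t)\<^sup>2) (at t)) \<and> \<psi> 0 = 0 \<and> (\<forall>t. \<psi> (- t) = - \<psi> t))"

lemma \<psi>_has_derivative: "(\<psi> has_real_derivative (\<phi>' t)\<^sup>2) (at t)"
  and \<psi>_0 [simp]: "\<psi> 0 = 0"
  and \<psi>_minus: "\<psi> (- t) = - \<psi> t"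
  using someI_ex[OF primitive_exists] unfolding \<psi>_def[symmetric] by blast+

text \<open>This is f' \<phi>^2 / f without the division. The required bound on f \<psi> is f times
  \<psi> <= (1 - d) \<eta>; both sides of the latter vanish at 0, so derivatives can be
  compared.\<close>

definition "\<eta> t = f' t * f t * (\<mu> t)\<^sup>2"

lemma \<eta>_0 [simp]: "\<eta> 0 = 0"
  by (simp add: \<eta>_def)

lemma \<eta>_pos: "\<eta> t > 0" if "t > 0"
  using f'_pos[OF that] pos[OF that] \<mu>_pos[of t] that by (simp add: \<eta>_def)

lemma continuous_on_\<eta>: "continuous_on A \<eta>"
  unfolding \<eta>_def[abs_def] 
  by (intro continuous_at_imp_continuous_on ballI continuous_intros isCont_f' isCont_f isCont_\<mu>)

lemma continuous_on_\<psi>: "continuous_on A \<psi>"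
  by (intro continuous_at_imp_continuous_on ballI DERIV_isCont[OF \<psi>_has_derivative])

text \<open>For c = 1 the bracket is f f'' - \<sigma>^2 f'^2, which is where
  \<open>b\<^sup>2 < lam\<close> comes from.\<close>

lemma difference_has_derivative:
  "((\<lambda>t. c * \<eta> t - \<psi> t) has_real_derivative
     (\<mu> t)\<^sup>2 * (c * (f t * f'' t) + (c * (1 + 2 * \<sigma> t) - (1 + \<sigma> t)\<^sup>2) * (f' t)\<^sup>2)) (at t)" if "t > 0"
proof -
  have "(\<eta> has_real_derivative
      (f'' t * f t + f' t * f' t) * (\<mu> t)\<^sup>2 + 2 * \<mu> t * (\<sigma> t * \<mu> t / f t * f' t) * (f' t * f t)) (at t)"
    unfolding \<eta>_def[abs_def]
    by (rule DERIV_cong[OF DERIV_mult[OF DERIV_mult[OF f'_has_derivative[OF that] f_has_derivative[OF that]]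
        DERIV_power[OF \<mu>_has_derivative[OF that]]]]) (simp add: algebra_simps)
  from DERIV_diff[OF DERIV_cmult[OF this, of c] \<psi>_has_derivative]
  show ?thesis
    by (rule DERIV_cong) (use pos[OF that] in \<open>simp add: \<phi>'_def power2_eq_square field_simps\<close>)
qed

lemma difference_mono:
  assumes "0 \<le> s" "s \<le> t"
    and "\<And>x. s < x \<Longrightarrow> x < t \<Longrightarrow> (1 + \<sigma> x)\<^sup>2 * (f' x)\<^sup>2 \<le> c * (f x * f'' x) + c * (1 + 2 * \<sigma> x) * (f' x)\<^sup>2"
  shows "c * \<eta> s - \<psi> s \<le> c * \<eta> t - \<psi> t"
proof (rule DERIV_nonneg_imp_increasing_open[OF assms(2)])
  fix x assume x: "s < x" "x < t"
  show "\<exists>y. ((\<lambda>t. c * \<eta> t - \<psi> t) has_real_derivative y) (at x) \<and> y \<ge> 0"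
    using x assms(1) assms(3)[OF x]
    by (intro exI[of _ "(\<mu> x)\<^sup>2 * (c * (f x * f'' x) + (c * (1 + 2 * \<sigma> x) - (1 + \<sigma> x)\<^sup>2) * (f' x)\<^sup>2)"]
        conjI difference_has_derivative mult_nonneg_nonneg) (simp_all add: algebra_simps)
qed (intro continuous_intros continuous_on_\<eta> continuous_on_\<psi>)

lemma f_f''_nonneg: "f x * f'' x \<ge> 0" if "x > 0"
  using pos[OF that] f''_nonneg[OF that] by simp

text \<open>A crude bound valid for every t >= 0, since it uses only f f'' >= 0 and \<sigma> <= 1:
  then 2 (1 + 2 \<sigma>) - (1 + \<sigma>)^2 = 1 + 2 \<sigma> - \<sigma>^2 >= 0. It serves the cross
  term of the energy estimate.\<close>

lemma \<psi>_le: "\<psi> t \<le> 2 * \<eta> t" if "t \<ge> 0"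
proof -
  have "2 * \<eta> 0 - \<psi> 0 \<le> 2 * \<eta> t - \<psi> t"
  proof (rule difference_mono)
    fix x :: real assume x: "0 < x"
    have "\<sigma> x * \<sigma> x \<le> 1 * 1" using \<sigma>_nonneg[of x] \<sigma>_le[of x] b by (intro mult_mono) auto
    then have "(1 + \<sigma> x)\<^sup>2 \<le> 2 * (1 + 2 * \<sigma> x)"
      using \<sigma>_nonneg[of x] by (simp add: power2_eq_square algebra_simps)
    from mult_right_mono[OF this, of "(f' x)\<^sup>2"] f_f''_nonneg[OF x]
    show "(1 + \<sigma> x)\<^sup>2 * (f' x)\<^sup>2 \<le> 2 * (f x * f'' x) + 2 * (1 + 2 * \<sigma> x) * (f' x)\<^sup>2" by simp
  qed (use that in auto)
  then show ?thesis by simp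
qed

lemma \<psi>_nonneg: "\<psi> t \<ge> 0" if "t \<ge> 0"
  using DERIV_nonneg_imp_nondecreasing[OF that, of \<psi>] \<psi>_has_derivative by (metis \<psi>_0 zero_le_power2)

lemma \<psi>_le_near_0:
  obtains d where "0 < d" "d < 1" "\<And>t. 0 \<le> t \<Longrightarrow> t \<le> t0 \<Longrightarrow> \<psi> t \<le> (1 - d) * \<eta> t"
proof -
  \<comment> \<open>This d solves (1 - d) (lam + 1 + 2 b) = (1 + b)^2, the equality case \<sigma> =
    b of the derivative comparison.\<close>
  define d where "d = (lam - b\<^sup>2) / (lam + 1 + 2 * b)"
  have "0 < lam - b\<^sup>2" "lam - b\<^sup>2 < lam + 1 + 2 * b"
    using b b2 zero_le_power2[of b] by linarith+
  then have d: "0 < d" "d < 1" using b lam by (simp_all add: d_def)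
  have deq: "(1 - d) * lam = b\<^sup>2 + d * (1 + 2 * b)"
    using lam b by (simp add: d_def field_simps)
  have "\<psi> t \<le> (1 - d) * \<eta> t" if t: "0 \<le> t" "t \<le> t0" for t
  proof -
    have "(1 - d) * \<eta> 0 - \<psi> 0 \<le> (1 - d) * \<eta> t - \<psi> t"
    proof (rule difference_mono)
      fix x assume x: "0 < x" "x < t"
      have "\<sigma> x * \<sigma> x \<le> b * b" "d * \<sigma> x \<le> d * b" 
        using \<sigma>_nonneg[of x] \<sigma>_le[of x] b d by (auto intro: mult_mono)
      then have "(1 + \<sigma> x)\<^sup>2 \<le> (1 - d) * lam + (1 - d) * (1 + 2 * \<sigma> x)"
        unfolding deq by (simp add: power2_eq_square algebra_simps)
      from mult_right_mono[OF this, of "(f' x)\<^sup>2"]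
      have "(1 + \<sigma> x)\<^sup>2 * (f' x)\<^sup>2 \<le> (1 - d) * (lam * (f' x)\<^sup>2) + (1 - d) * (1 + 2 * \<sigma> x) * (f' x)\<^sup>2"
        by (simp add: algebra_simps)
      also have "\<dots> \<le> (1 - d) * (f x * f'' x) + (1 - d) * (1 + 2 * \<sigma> x) * (f' x)\<^sup>2"
        using lower[of x] x t d by (intro add_right_mono mult_left_mono) auto
      finally show "(1 + \<sigma> x)\<^sup>2 * (f' x)\<^sup>2 \<le> (1 - d) * (f x * f'' x) + (1 - d) * (1 + 2 * \<sigma> x) * (f' x)\<^sup>2" .
    qed (use t in auto)
    then show ?thesis by simp
  qed
  with d that show ?thesis by blast
qed

text \<open>Past t0 the gap \<eta> - \<psi> no longer shrinks, so it stays at least d \<eta>(t0).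
  Dividing by a bound B of \<eta> on [0, M] makes this a proportion e of \<eta>.\<close>

lemma \<psi>_le_strict:
  assumes M: "M > 0"
  obtains d where "0 < d" "d < 1" "\<And>t. 0 \<le> t \<Longrightarrow> t \<le> M \<Longrightarrow> \<psi> t \<le> (1 - d) * \<eta> t"
proof -
  obtain d where d: "0 < d" "d < 1" and near: "\<And>t. 0 \<le> t \<Longrightarrow> t \<le> t0 \<Longrightarrow> \<psi> t \<le> (1 - d) * \<eta> t"
    by (rule \<psi>_le_near_0) blast
  have "bounded (\<eta> ` {0..M})"
    by (intro compact_imp_bounded compact_continuous_image continuous_on_\<eta>) simp
  then obtain B where B: "B > 0" "\<And>t. t \<in> {0..M} \<Longrightarrow> \<eta> t \<le> B"
    unfolding bounded_pos by (auto simp: abs_le_iff)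
  define e where "e = d * \<eta> t0 / B"
  have e: "e > 0" using d \<eta>_pos[OF t0] B by (simp add: e_def)
  have "\<psi> t \<le> (1 - min d e) * \<eta> t" if t: "0 \<le> t" "t \<le> M" for t
  proof (cases "t \<le> t0")
    case True
    have "\<eta> t \<ge> 0" using \<eta>_pos[of t] t by (cases "t = 0") auto
    then have "(1 - d) * \<eta> t \<le> (1 - min d e) * \<eta> t" by (intro mult_right_mono) auto
    then show ?thesis using near[OF t(1) True] by simp
  next
    case False
    have "1 * \<eta> t0 - \<psi> t0 \<le> 1 * \<eta> t - \<psi> t"
    proof (rule difference_mono)
      fix x assume "t0 < x"
      then show "(1 + \<sigma> x)\<^sup>2 * (f' x)\<^sup>2 \<le> 1 * (f x * f'' x) + 1 * (1 + 2 * \<sigma> x) * (f' x)\<^sup>2"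
        using \<sigma>_eq_0[of x] f_f''_nonneg[of x] t0 by simp
    qed (use False t0 in auto)
    then have "\<psi> t \<le> \<eta> t - d * \<eta> t0"
      using near[of t0] t0 by (simp add: algebra_simps)
    moreover have "d * \<eta> t0 = e * B" using B by (simp add: e_def)
    moreover have "min d e * \<eta> t \<le> e * B"
      using B(2)[of t] t d e \<eta>_pos[of t] False t0 by (intro mult_mono) auto
    ultimately show ?thesis by (simp add: algebra_simps)
  qed
  then show ?thesis using that[of "min d e"] d e by auto
qed

text \<open>The product \<phi> \<phi>' equals (1 + \<sigma>) \<eta> for t >= 0. In this form \<psi>
  grad u can be split into a factor \<phi>' |grad u|, which the energy controls, and a factor
  |\<phi>|.\<close>

lemma \<psi>_abs_le: "\<bar>\<psi> t\<bar> \<le> 2 * \<bar>\<phi> t\<bar> * \<phi>' t"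
proof -
  have p: "\<bar>\<psi> t\<bar> \<le> 2 * \<bar>\<phi> t\<bar> * \<phi>' t" if "t \<ge> 0" for t
  proof -
    have "\<eta> t \<le> (1 + \<sigma> t) * \<eta> t"
      using \<sigma>_nonneg[of t] \<eta>_pos[of t] that by (cases "t = 0") auto
    also have "\<dots> = \<bar>\<phi> t\<bar> * \<phi>' t"
      using f_nonneg[OF that] \<mu>_nonneg[of t] by (simp add: \<eta>_def \<phi>_def \<phi>'_def power2_eq_square abs_mult)
    finally show ?thesis using \<psi>_le[OF that] \<psi>_nonneg[OF that] by simp
  qed
  show ?thesis
    using p[of t] p[of "- t"] by (cases "t \<ge> 0") (auto simp: \<psi>_minus \<phi>_minus \<phi>'_minus)
qed

lemma f_\<psi>_le:
  assumes M: "M > 0"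
  obtains d where "0 < d" "d < 1" "\<And>t. \<bar>t\<bar> \<le> M \<Longrightarrow> f t * \<psi> t \<le> (1 - d) * (f' t * (\<phi> t)\<^sup>2)"
proof -
  obtain d where d: "0 < d" "d < 1" and le: "\<And>t. 0 \<le> t \<Longrightarrow> t \<le> M \<Longrightarrow> \<psi> t \<le> (1 - d) * \<eta> t"
    by (rule \<psi>_le_strict[OF M]) blast
  have p: "f t * \<psi> t \<le> (1 - d) * (f' t * (\<phi> t)\<^sup>2)" if "0 \<le> t" "t \<le> M" for t
    using mult_left_mono[OF le[OF that] f_nonneg[OF that(1)]]
    by (simp add: \<eta>_def \<phi>_def power2_eq_square algebra_simps)
  have "f t * \<psi> t \<le> (1 - d) * (f' t * (\<phi> t)\<^sup>2)" if "\<bar>t\<bar> \<le> M" for t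
    using p[of t] p[of "- t"] that by (cases "t \<ge> 0") (auto simp: odd \<psi>_minus \<phi>_minus f'_minus)
  with d that show ?thesis by blast
qed

end

section \<open>Gradients and integration by parts\<close>

lemma gradient_eqI:
  fixes g :: "real ^ 'n::finite \<Rightarrow> real"
  assumes "(g has_derivative (\<lambda>h. v \<bullet> h)) (at x)"
  shows "gradient g x = v" and "partial i g x = v $ i"
  using frechet_derivative_at[OF assms, symmetric]
  by (simp_all add: gradient_def partial_def vec_eq_iff inner_axis)

lemma differentiable_has_gradient:
  fixes g :: "real ^ 'n::finite \<Rightarrow> real"
  assumes "g differentiable (at x)"
  shows "(g has_derivative (\<lambda>h. gradient g x \<bullet> h)) (at x)"
proof -
  define L where "L = frechet_derivative g (at x)"
  have L: "(g has_derivative L) (at x)"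
    using assms unfolding L_def by (simp add: frechet_derivative_works)
  then have lin: "linear L" by (rule has_derivative_linear)
  have "L h = gradient g x \<bullet> h" for h
  proof -
    have "L h = L (\<Sum>i\<in>UNIV. h $ i *\<^sub>R axis i 1)"
      using basis_expansion[of h] by (simp add: scalar_mult_eq_scaleR)
    also have "\<dots> = (\<Sum>i\<in>UNIV. h $ i * L (axis i 1))"
      by (simp add: linear_sum[OF lin] linear_scale[OF lin])
    also have "\<dots> = gradient g x \<bullet> h"
      by (simp add: gradient_def partial_def L_def inner_vec_def mult.commute)
    finally show ?thesis .
  qed
  then have "L = (\<lambda>h. gradient g x \<bullet> h)" by blast
  with L show ?thesis by simp
qed

lemma C1_has_derivative:
  "C1 g \<Longrightarrow> (g has_derivative (\<lambda>h. gradient g x \<bullet> h)) (at x)"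
  by (simp add: C1_def differentiable_has_gradient)

lemma C1_continuous: "C1 g \<Longrightarrow> continuous_on UNIV g"
  by (intro continuous_at_imp_continuous_on ballI differentiable_imp_continuous_within) (simp add: C1_def)

lemma C1_continuous_gradient: "C1 g \<Longrightarrow> continuous_on UNIV (gradient g)"
  unfolding C1_def gradient_def[abs_def] by (intro continuous_on_vec_lambda) auto

lemma C1I:
  fixes g :: "real ^ 'n::finite \<Rightarrow> real"
  assumes "\<And>x. (g has_derivative (\<lambda>h. v x \<bullet> h)) (at x)" and "continuous_on UNIV v"
  shows "C1 g"
proof -
  have "partial i g = (\<lambda>x. v x $ i)" for i
    using gradient_eqI(2)[OF assms(1)] by blast
  then show ?thesis
    unfolding C1_def using assms
    by (auto simp: differentiable_def intro: continuous_on_component)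
qed

lemma integrable_continuous_compact_support:
  fixes g :: "'a::euclidean_space \<Rightarrow> real"
  assumes "continuous_on UNIV g" and "\<And>x. x \<notin> cball 0 R \<Longrightarrow> g x = 0"
  shows "integrable lborel g"
proof -
  have "integrable lborel (\<lambda>x. indicator (cball 0 R) x *\<^sub>R g x)"
    by (rule borel_integrable_compact) (use assms(1) continuous_on_subset in auto)
  moreover have "(\<lambda>x. indicator (cball 0 R) x *\<^sub>R g x) = g"
    by (rule ext) (use assms(2) in \<open>auto simp: indicator_def\<close>)
  ultimately show ?thesis by simp
qed

text \<open>Difference quotients integrate to 0 by translation invariance of Lebesgue measure, and
  they converge to the partial derivative under a common bound.\<close>

lemma integral_partial_eq_0:
  fixes g :: "real ^ 'n::finite \<Rightarrow> real"
  assumes g: "C1 g" and supp: "\<And>x. x \<notin> cball 0 R \<Longrightarrow> g x = 0"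
  shows "(\<integral>x. partial i g x \<partial>lborel) = 0"
proof -
  define e :: "real ^ 'n" where "e = axis i 1"
  define h where "h n = inverse (real (Suc n))" for n
  define s where "s n x = (g (h n *\<^sub>R e + x) - g x) / h n" for n x
  have e: "norm e = 1" by (simp add: e_def)
  have h: "0 < h n" "h n \<le> 1" for n by (simp_all add: h_def inverse_le_1_iff)
  have h0: "h \<longlonglongrightarrow> 0" unfolding h_def by (rule LIMSEQ_inverse_real_of_nat)
  have cont: "continuous_on UNIV g" using g by (rule C1_continuous)
  have int: "integrable lborel g"
    using cont supp by (rule integrable_continuous_compact_support)
  have meas [measurable]: "g \<in> borel_measurable borel"
    using cont by (rule borel_measurable_continuous_onI)
  have pmeas [measurable]: "partial i g \<in> borel_measurable borel"
    using g unfolding C1_def by (intro borel_measurable_continuous_onI) blast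
  have line: "((\<lambda>t. g (t *\<^sub>R e + x)) has_real_derivative partial i g (t *\<^sub>R e + x)) (at t)" for t x
  proof -
    have "((\<lambda>t. g (t *\<^sub>R e + x)) has_derivative (\<lambda>k. gradient g (t *\<^sub>R e + x) \<bullet> (k *\<^sub>R e))) (at t)"
      by (rule has_derivative_compose[where f = "\<lambda>t. t *\<^sub>R e + x", OF _ C1_has_derivative[OF g]])
        (auto intro!: derivative_eq_intros)
    then show ?thesis
      by (simp add: has_field_derivative_def e_def inner_axis gradient_def mult_commute_abs)
  qed
  have shift: "(\<integral>x. g (c + x) \<partial>lborel) = (\<integral>x. g x \<partial>lborel)"
    and shift_int: "integrable lborel (\<lambda>x. g (c + x))" for c
  proof -
    have d: "distr lborel borel ((+) c) = lborel" by (rule lborel_distr_plus)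
    show "(\<integral>x. g (c + x) \<partial>lborel) = (\<integral>x. g x \<partial>lborel)"
      using integral_distr[of "(+) c" lborel borel g] by (simp add: d)
    show "integrable lborel (\<lambda>x. g (c + x))"
      using integrable_distr_eq[of "(+) c" lborel borel g] int by (simp add: d)
  qed
  have s0: "(\<integral>x. s n x \<partial>lborel) = 0" for n
    unfolding s_def using shift shift_int int by simp
  \<comment> \<open>Since the steps \<open>h n\<close> are at most 1, the quotients vanish outside
    radius R + 1, and inside it the mean value points stay within radius R + 2.\<close>
  have "bounded (partial i g ` cball 0 (R + 2))"
    using g unfolding C1_def
    by (intro compact_imp_bounded compact_continuous_image compact_cball) (metis continuous_on_subset subset_UNIV)
  then obtain B where B: "\<And>x. x \<in> cball 0 (R + 2) \<Longrightarrow> \<bar>partial i g x\<bar> \<le> B" and "B > 0"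
    unfolding bounded_pos by (metis imageI real_norm_def)
  have "(\<lambda>n. \<integral>x. s n x \<partial>lborel) \<longlonglongrightarrow> (\<integral>x. partial i g x \<partial>lborel)"
  proof (rule integral_dominated_convergence)
    show "integrable lborel (\<lambda>x. indicator (cball 0 (R + 1)) x * B)"
      by (auto intro!: integrable_mult_left emeasure_compact_finite)
    show "AE x in lborel. (\<lambda>n. s n x) \<longlonglongrightarrow> partial i g x"
    proof (rule AE_I2)
      fix x
      have "((\<lambda>k. (g (k *\<^sub>R e + x) - g x) / k) \<longlongrightarrow> partial i g x) (at 0)"
        using line[of x 0] by (simp add: has_field_derivative_iff)
      moreover have "filterlim h (at 0) sequentially"
        using h0 h by (auto simp: filterlim_at less_imp_neq[symmetric])
      ultimately show "(\<lambda>n. s n x) \<longlonglongrightarrow> partial i g x"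
        unfolding s_def by (rule filterlim_compose)
    qed
    show "AE x in lborel. norm (s n x) \<le> indicator (cball 0 (R + 1)) x * B" for n
    proof (rule AE_I2)
      fix x
      show "norm (s n x) \<le> indicator (cball 0 (R + 1)) x * B"
      proof (cases "x \<in> cball 0 (R + 1)")
        case True
        obtain z where z: "0 < z" "z < h n"
          "g (h n *\<^sub>R e + x) - g (0 *\<^sub>R e + x) = (h n - 0) * partial i g (z *\<^sub>R e + x)"
          using MVT2[OF h(1)[of n], of "\<lambda>t. g (t *\<^sub>R e + x)" "\<lambda>t. partial i g (t *\<^sub>R e + x)"] line by blast
        then have "s n x = partial i g (z *\<^sub>R e + x)"
          using h(1)[of n] by (simp add: s_def)
        moreover have "z *\<^sub>R e + x \<in> cball 0 (R + 2)"
          using norm_triangle_ineq[of "z *\<^sub>R e" x] True z h(2)[of n] e by simp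
        ultimately show ?thesis using B True by simp
      next
        case False
        then have "R + 1 < norm x" by simp
        moreover have "norm x \<le> norm (h n *\<^sub>R e + x) + norm (h n *\<^sub>R e)"
          using norm_triangle_ineq4[of "h n *\<^sub>R e + x" "h n *\<^sub>R e"] by simp
        ultimately have "h n *\<^sub>R e + x \<notin> cball 0 R" "x \<notin> cball 0 R"
          using h[of n] e by auto
        then show ?thesis using False supp by (simp add: s_def)
      qed
    qed
  qed (simp_all add: s_def)
  then show ?thesis using s0 LIMSEQ_unique[OF _ tendsto_const[of 0]] by simp
qed

section \<open>The energy estimate\<close>

text \<open>Stability bounds the integral of K = f'(u) \<phi>(u)^2 \<zeta>^2 by that of |w|^2, w
  being the gradient of \<phi>(u) \<zeta>. The tested equation says that E has integral 0. A
  pointwise inequality with a multiple of E then removes grad u from the bound.\<close>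

lemma stable_solution_energy_estimate:
  fixes u \<zeta> :: "real ^ 'n::finite \<Rightarrow> real" and z :: "real ^ 'n \<Rightarrow> real ^ 'n"
  assumes sol: "solution f u" and stab: "stable f u"
    and cont_f: "continuous_on UNIV f" and cont_f': "continuous_on UNIV (deriv f)"
    and \<phi>: "\<And>t. (\<phi> has_real_derivative \<phi>' t) (at t)"
    and cont_\<phi>': "continuous_on UNIV \<phi>'" and \<phi>'_nonneg: "\<And>t. \<phi>' t \<ge> 0"
    and \<psi>: "\<And>t. (\<psi> has_real_derivative (\<phi>' t)\<^sup>2) (at t)"
    and \<psi>_le: "\<And>t. \<bar>\<psi> t\<bar> \<le> 2 * \<bar>\<phi> t\<bar> * \<phi>' t"
    and d: "0 < d" "d < 1"
    and f_\<psi>: "\<And>x. f (u x) * \<psi> (u x) \<le> (1 - d) * (deriv f (u x) * (\<phi> (u x))\<^sup>2)"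
    and f'_nonneg: "\<And>t. deriv f t \<ge> 0"
    and \<zeta>: "\<And>x. (\<zeta> has_derivative (\<lambda>h. z x \<bullet> h)) (at x)"
    and cont_z: "continuous_on UNIV z"
    and supp: "\<And>x. x \<notin> cball 0 R \<Longrightarrow> \<zeta> x = 0" "\<And>x. x \<notin> cball 0 R \<Longrightarrow> z x = 0"
  shows "(\<integral>x. d / 2 * (deriv f (u x) * (\<phi> (u x))\<^sup>2 * (\<zeta> x)\<^sup>2) \<partial>lborel)
       \<le> (\<integral>x. (32 / d + 1) * ((\<phi> (u x))\<^sup>2 * (norm (z x))\<^sup>2) \<partial>lborel)"
proof -
  have C1u: "C1 u" and C1u': "\<And>i. C1 (partial i u)" and eq: "\<And>x. laplacian u x = - f (u x)"
    using sol by (auto simp: solution_def C2_def minus_equation_iff[of "laplacian u _"] eq_commute)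
  have cont_u [continuous_intros]: "continuous_on A u" for A
    using C1_continuous[OF C1u] continuous_on_subset by blast
  have cont_gu [continuous_intros]: "continuous_on A (gradient u)" for A
    using C1_continuous_gradient[OF C1u] continuous_on_subset by blast
  have cont_pu [continuous_intros]: "continuous_on A (partial i u)" for i A
    using C1_continuous[OF C1u'] continuous_on_subset by blast
  have cont_gpu [continuous_intros]: "continuous_on A (gradient (partial i u))" for i A
    using C1_continuous_gradient[OF C1u'] continuous_on_subset by blast
  have cont_\<zeta> [continuous_intros]: "continuous_on A \<zeta>" for A
    using \<zeta> by (meson has_derivative_continuous continuous_at_imp_continuous_on)
  have cont_z' [continuous_intros]: "continuous_on A z" for A
    using cont_z continuous_on_subset by blast
  have comp: "continuous_on A (\<lambda>x. g (u x))" if "continuous_on UNIV g" for g :: "real \<Rightarrow> real" and A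
    by (rule continuous_on_compose2[OF that cont_u]) simp
  have cont_fu [continuous_intros]: "continuous_on A (\<lambda>x. f (u x))" for A
    using cont_f by (rule comp)
  have cont_f'u [continuous_intros]: "continuous_on A (\<lambda>x. deriv f (u x))" for A
    using cont_f' by (rule comp)
  have cont_\<phi>'u [continuous_intros]: "continuous_on A (\<lambda>x. \<phi>' (u x))" for A
    using cont_\<phi>' by (rule comp)
  have cont_\<phi>u [continuous_intros]: "continuous_on A (\<lambda>x. \<phi> (u x))" for A
    using \<phi> by (intro comp continuous_at_imp_continuous_on ballI DERIV_isCont)
  have cont_\<psi>u [continuous_intros]: "continuous_on A (\<lambda>x. \<psi> (u x))" for A
    using \<psi> by (intro comp continuous_at_imp_continuous_on ballI DERIV_isCont)
  note integrableI = integrable_continuous_compact_support[where R = R]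
  have du: "(u has_derivative (\<lambda>h. gradient u x \<bullet> h)) (at x)" for x
    using C1u by (rule C1_has_derivative)
  have dpu: "(partial i u has_derivative (\<lambda>h. gradient (partial i u) x \<bullet> h)) (at x)" for i x
    using C1u' by (rule C1_has_derivative)
  have d\<phi>u: "((\<lambda>x. \<phi> (u x)) has_derivative (\<lambda>h. \<phi>' (u x) * (gradient u x \<bullet> h))) (at x)" for x
    using has_derivative_compose[OF du \<phi>[unfolded has_field_derivative_def]] by simp
  have d\<psi>u: "((\<lambda>x. \<psi> (u x)) has_derivative (\<lambda>h. (\<phi>' (u x))\<^sup>2 * (gradient u x \<bullet> h))) (at x)" for x
    using has_derivative_compose[OF du \<psi>[unfolded has_field_derivative_def]] by simp

  define T where "T x = \<phi> (u x) * \<zeta> x" for x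
  define w where "w x = (\<phi>' (u x) * \<zeta> x) *\<^sub>R gradient u x + \<phi> (u x) *\<^sub>R z x" for x
  have dT: "(T has_derivative (\<lambda>h. w x \<bullet> h)) (at x)" for x
    unfolding T_def[abs_def]
    by (rule has_derivative_eq_rhs[OF has_derivative_mult[OF d\<phi>u \<zeta>]])
      (simp add: w_def fun_eq_iff inner_add_left algebra_simps)
  have cont_w: "continuous_on UNIV w" unfolding w_def by (intro continuous_intros)
  have "C1 T" using dT cont_w by (rule C1I)
  moreover have "{x. T x \<noteq> 0} \<subseteq> cball 0 R" 
    unfolding T_def using supp(1) by (metis (mono_tags, lifting) mem_Collect_eq mult_zero_right subsetI)
  then have "compact (closure {x. T x \<noteq> 0})"
    by (metis bounded_cball bounded_subset compact_closure)
  ultimately have "C1_compact_support T" by (simp add: C1_compact_support_def)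
  from stab[unfolded stable_def, rule_format, OF this]
  have stability: "(\<integral>x. deriv f (u x) * (T x)\<^sup>2 \<partial>lborel) \<le> (\<integral>x. (norm (w x))\<^sup>2 \<partial>lborel)"
    unfolding gradient_eqI(1)[OF dT] .

  \<comment> \<open>The \<open>G i\<close> are the components of the field \<psi>(u) \<zeta>^2 grad
    u. Its divergence is \<open>E\<close>, with the Laplacian of u replaced by -f(u).\<close>
  define G where "G i x = \<psi> (u x) * (\<zeta> x)\<^sup>2 * partial i u x" for i x
  define g where "g i x = ((\<phi>' (u x))\<^sup>2 * (\<zeta> x)\<^sup>2 * partial i u x) *\<^sub>R gradient u x
    + (2 * \<psi> (u x) * \<zeta> x * partial i u x) *\<^sub>R z x + (\<psi> (u x) * (\<zeta> x)\<^sup>2) *\<^sub>R gradient (partial i u) x" for i x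
  have dG: "(G i has_derivative (\<lambda>h. g i x \<bullet> h)) (at x)" for i x
    unfolding G_def[abs_def] power2_eq_square
    by (rule has_derivative_eq_rhs[OF has_derivative_mult[OF has_derivative_mult[OF d\<psi>u has_derivative_mult[OF \<zeta> \<zeta>]] dpu]])
      (simp add: g_def fun_eq_iff inner_add_left power2_eq_square algebra_simps)
  have cont_g: "continuous_on UNIV (g i)" for i unfolding g_def by (intro continuous_intros)
  define E where "E x = (\<phi>' (u x))\<^sup>2 * (\<zeta> x)\<^sup>2 * (norm (gradient u x))\<^sup>2
    + 2 * \<psi> (u x) * \<zeta> x * (gradient u x \<bullet> z x) - f (u x) * \<psi> (u x) * (\<zeta> x)\<^sup>2" for x
  have E: "E x = (\<Sum>i\<in>UNIV. partial i (G i) x)" for x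
  proof -
    have "(norm (gradient u x))\<^sup>2 = (\<Sum>i\<in>UNIV. partial i u x * partial i u x)"
      by (simp add: power2_norm_eq_inner inner_vec_def gradient_def)
    moreover have "gradient u x \<bullet> z x = (\<Sum>i\<in>UNIV. partial i u x * z x $ i)"
      by (simp add: inner_vec_def gradient_def)
    moreover have "f (u x) = - (\<Sum>i\<in>UNIV. partial i (partial i u) x)"
      using eq[of x] by (simp add: laplacian_def)
    moreover have "partial i (G i) x = g i x $ i" for i
      by (rule gradient_eqI(2)[OF dG])
    ultimately show ?thesis
      by (simp add: E_def g_def gradient_def sum.distrib sum_distrib_left sum_distrib_right mult.assoc algebra_simps)
  qed
  have int_G: "integrable lborel (\<lambda>x. partial i (G i) x)" for i
  proof (rule integrableI)
    show "continuous_on UNIV (\<lambda>x. partial i (G i) x)"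
      unfolding gradient_eqI(2)[OF dG] using cont_g by (intro continuous_intros)
    show "partial i (G i) x = 0" if "x \<notin> cball 0 R" for x
      unfolding gradient_eqI(2)[OF dG] using supp[OF that] by (simp add: g_def)
  qed
  have "(\<integral>x. partial i (G i) x \<partial>lborel) = 0" for i
    by (rule integral_partial_eq_0[OF C1I[OF dG cont_g], of R]) (simp add: G_def supp(1))
  then have weak: "(\<integral>x. E x \<partial>lborel) = 0"
    unfolding E using int_G by simp

  define K where "K x = deriv f (u x) * (\<phi> (u x))\<^sup>2 * (\<zeta> x)\<^sup>2" for x
  define B where "B x = (\<phi> (u x))\<^sup>2 * (norm (z x))\<^sup>2" for x
  have iK: "integrable lborel K"
    unfolding K_def by (rule integrableI) (auto intro!: continuous_intros simp: supp)
  have iB: "integrable lborel B"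
    unfolding B_def by (rule integrableI) (auto intro!: continuous_intros simp: supp)
  have iw: "integrable lborel (\<lambda>x. (norm (w x))\<^sup>2)"
    using cont_w by (intro integrableI continuous_intros) (auto simp: supp w_def)
  have iE: "integrable lborel E"
    unfolding E_def by (rule integrableI) (auto intro!: continuous_intros simp: supp)

  \<comment> \<open>The weight 1 + d / 2 on \<open>E\<close> leaves d/2 \<alpha>^2 to spare, and
    since (1 + d/2) (1 - d) <= 1 - d/2 it still leaves d/2 K. The cross terms amount to (6 + 2 d)
    \<alpha> \<beta> <= 8 \<alpha> \<beta>, which the spare d/2 \<alpha>^2 absorbs at the price of
    32/d \<beta>^2. After integration, stability cancels K against |w|^2.\<close>
  have pointwise: "d / 2 * K x + (norm (w x))\<^sup>2 \<le> (32 / d + 1) * B x + (1 + d / 2) * E x + K x" for x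
  proof -
    define \<alpha> where "\<alpha> = \<phi>' (u x) * \<bar>\<zeta> x\<bar> * norm (gradient u x)"
    define \<beta> where "\<beta> = \<bar>\<phi> (u x)\<bar> * norm (z x)"
    define S where "S = f (u x) * \<psi> (u x) * (\<zeta> x)\<^sup>2"
    have nn: "\<alpha> \<ge> 0" "\<beta> \<ge> 0" "K x \<ge> 0"
      using \<phi>'_nonneg f'_nonneg by (simp_all add: \<alpha>_def \<beta>_def K_def)
    have "norm (w x) \<le> \<alpha> + \<beta>"
      unfolding w_def \<alpha>_def \<beta>_def using \<phi>'_nonneg
      by (intro norm_triangle_le) (simp add: abs_mult)
    then have w2: "(norm (w x))\<^sup>2 \<le> (\<alpha> + \<beta>)\<^sup>2" by (intro power_mono) auto
    have "\<bar>\<psi> (u x) * \<zeta> x * (gradient u x \<bullet> z x)\<bar>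
        \<le> (2 * \<bar>\<phi> (u x)\<bar> * \<phi>' (u x)) * \<bar>\<zeta> x\<bar> * (norm (gradient u x) * norm (z x))"
      unfolding abs_mult using \<psi>_le \<phi>'_nonneg
      by (intro mult_mono Cauchy_Schwarz_ineq2) auto
    then have cross: "2 * \<psi> (u x) * \<zeta> x * (gradient u x \<bullet> z x) \<ge> - (4 * \<alpha> * \<beta>)"
      by (simp add: \<alpha>_def \<beta>_def ac_simps)
    have "S \<le> (1 - d) * K x"
      using mult_right_mono[OF f_\<psi>[of x], of "(\<zeta> x)\<^sup>2"] by (simp add: S_def K_def ac_simps)
    then have "E x \<ge> \<alpha>\<^sup>2 - 4 * \<alpha> * \<beta> - (1 - d) * K x"
    proof -
      have "\<alpha>\<^sup>2 = (\<phi>' (u x))\<^sup>2 * (\<zeta> x)\<^sup>2 * (norm (gradient u x))\<^sup>2"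
        by (simp add: \<alpha>_def power_mult_distrib)
      then show ?thesis
        using cross \<open>S \<le> (1 - d) * K x\<close> unfolding E_def S_def by linarith
    qed
    then have E_ge: "(1 + d / 2) * E x \<ge> (1 + d / 2) * (\<alpha>\<^sup>2 - 4 * \<alpha> * \<beta> - (1 - d) * K x)"
      using d by (intro mult_left_mono) auto
    have "0 \<le> d / 2 * (\<alpha> - 8 * \<beta> / d)\<^sup>2" using d by simp
    also have "\<dots> = d / 2 * \<alpha>\<^sup>2 - 8 * (\<alpha> * \<beta>) + 32 / d * \<beta>\<^sup>2"
      using d by (simp add: power2_eq_square field_simps)
    finally have sq: "8 * (\<alpha> * \<beta>) \<le> d / 2 * \<alpha>\<^sup>2 + 32 / d * \<beta>\<^sup>2" by simp
    have "d * (\<alpha> * \<beta>) \<le> 1 * (\<alpha> * \<beta>)" "0 \<le> d * d * K x"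
      using d nn by (intro mult_right_mono mult_nonneg_nonneg; simp)+
    then have "d / 2 * K x + (\<alpha> + \<beta>)\<^sup>2 \<le> (32 / d + 1) * \<beta>\<^sup>2
        + (1 + d / 2) * (\<alpha>\<^sup>2 - 4 * \<alpha> * \<beta> - (1 - d) * K x) + K x"
      using sq by (simp add: power2_eq_square algebra_simps)
    moreover have "B x = \<beta>\<^sup>2" by (simp add: B_def \<beta>_def power_mult_distrib)
    ultimately show ?thesis using w2 E_ge by simp
  qed
  have "(\<integral>x. d / 2 * K x + (norm (w x))\<^sup>2 \<partial>lborel)
      \<le> (\<integral>x. (32 / d + 1) * B x + (1 + d / 2) * E x + K x \<partial>lborel)"
    using pointwise iK iB iw iE by (intro integral_mono) auto
  then have "d / 2 * (\<integral>x. K x \<partial>lborel) + (\<integral>x. (norm (w x))\<^sup>2 \<partial>lborel)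
      \<le> (32 / d + 1) * (\<integral>x. B x \<partial>lborel) + (\<integral>x. K x \<partial>lborel)"
    using iK iB iw iE weak by simp
  moreover have "(\<integral>x. K x \<partial>lborel) \<le> (\<integral>x. (norm (w x))\<^sup>2 \<partial>lborel)"
    using stability by (simp add: K_def T_def power_mult_distrib mult.assoc)
  ultimately show ?thesis
    unfolding K_def[symmetric] B_def[symmetric] by simp
qed

section \<open>Decay of the weighted integral\<close>

definition bump :: "nat \<Rightarrow> real \<Rightarrow> 'a::real_inner \<Rightarrow> real" where
  "bump m R x = max 0 (1 - x \<bullet> x / R\<^sup>2) ^ m"

definition bump_gradient :: "nat \<Rightarrow> real \<Rightarrow> 'a::real_inner \<Rightarrow> 'a" where
  "bump_gradient m R x = (- (2 * real m / R\<^sup>2) * bump (m - 1) R x) *\<^sub>R x"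

lemma bump_nonneg: "bump m R x \<ge> 0"
  by (simp add: bump_def)

text \<open>The exponent has to be positive: 0^0 = 1, so \<open>bump 0 R\<close> is 1
  everywhere.\<close>

lemma bump_outside: "bump (Suc m) R x = 0" if "x \<notin> cball 0 R" "R > 0"
proof -
  have "R\<^sup>2 \<le> (norm x)\<^sup>2" using that by (intro power_mono) auto
  then show ?thesis using that by (simp add: bump_def max_def power2_norm_eq_inner field_simps)
qed

lemma bump_has_derivative:
  "(bump (Suc (Suc m)) R has_derivative (\<lambda>h. bump_gradient (Suc (Suc m)) R x \<bullet> h)) (at x)"
proof -
  have "((\<lambda>x. 1 - inverse (R\<^sup>2) * (x \<bullet> x)) has_derivative (\<lambda>h. - (inverse (R\<^sup>2) * (x \<bullet> h + h \<bullet> x)))) (at x)"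
    by (auto intro!: derivative_eq_intros)
  then have "((\<lambda>x. 1 - x \<bullet> x / R\<^sup>2) has_derivative (\<lambda>h. - (2 / R\<^sup>2) * (x \<bullet> h))) (at x)"
    by (simp add: divide_inverse inner_commute mult.commute mult.left_commute)
  from has_derivative_compose[OF this max_zero_power_has_derivative[unfolded has_field_derivative_def]]
  show ?thesis
    unfolding bump_gradient_def bump_def[abs_def]
    by (rule has_derivative_eq_rhs) (simp add: fun_eq_iff)
qed

lemma continuous_on_bump: "continuous_on A (bump m R)"
  unfolding bump_def[abs_def] divide_inverse by (intro continuous_intros)

lemma continuous_on_bump_gradient: "continuous_on A (bump_gradient m R)"
  unfolding bump_gradient_def[abs_def] by (intro continuous_intros continuous_on_bump)

text \<open>On the ball, |x| / R^2 <= 1 / R. One power of the base is lost; a high exponent of the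
  bump makes up for it later.\<close>

lemma norm_bump_gradient_le: "norm (bump_gradient (Suc (Suc m)) R x) \<le> 2 * real (Suc (Suc m)) / R * bump (Suc m) R x" if "R > 0"
proof (cases "x \<in> cball 0 R")
  case True
  have "norm (bump_gradient (Suc (Suc m)) R x) = 2 * real (Suc (Suc m)) / R\<^sup>2 * bump (Suc m) R x * norm x"
    using bump_nonneg[of "Suc m" R x] by (simp add: bump_gradient_def abs_mult)
  also have "\<dots> \<le> 2 * real (Suc (Suc m)) / R\<^sup>2 * bump (Suc m) R x * R"
    using True bump_nonneg[of "Suc m" R x] by (intro mult_left_mono) auto
  also have "\<dots> = 2 * real (Suc (Suc m)) / R * bump (Suc m) R x"
    using that by (simp add: power2_eq_square)
  finally show ?thesis .
next
  case False
  then show ?thesis using bump_outside[OF False that] that by (simp add: bump_gradient_def)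
qed

(* Replaces Young's inequality: where A > d p, the lower bound on p makes w, and hence y, small. *)
lemma absorb_into_power:
  fixes A c d e p w y :: real
  assumes "c > 0" "d > 0" "kap > 0" "a > 0" "A \<ge> 0" "w \<ge> 0" "p \<ge> 0"
    and p: "p \<ge> c * w powr kap" and y: "\<bar>y\<bar> \<le> e * w powr a"
  shows "A * y\<^sup>2 \<le> d * p * y\<^sup>2 + e\<^sup>2 * (1 / (d * c)) powr (2 * a / kap) * A powr (1 + 2 * a / kap)"
proof (cases "A \<le> d * p")
  case True
  then have "A * y\<^sup>2 \<le> d * p * y\<^sup>2" by (intro mult_right_mono) auto
  then show ?thesis by (simp add: add_increasing2)
next
  case False
  then have "d * (c * w powr kap) < A" using p assms(2) by (meson le_less_trans mult_left_mono not_le less_imp_le)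
  then have le: "w powr kap \<le> 1 / (d * c) * A" using assms(1,2) by (simp add: field_simps)
  have "(w powr a)\<^sup>2 = (w powr kap) powr (2 * a / kap)"
    using assms(3) by (simp add: powr_powr power2_eq_square powr_add[symmetric])
  also have "\<dots> \<le> (1 / (d * c) * A) powr (2 * a / kap)"
    using le assms by (intro powr_mono2) auto
  also have "\<dots> = (1 / (d * c)) powr (2 * a / kap) * A powr (2 * a / kap)"
    using assms by (intro powr_mult)
  finally have w: "(w powr a)\<^sup>2 \<le> (1 / (d * c)) powr (2 * a / kap) * A powr (2 * a / kap)" .
  have "y\<^sup>2 \<le> (e * w powr a)\<^sup>2" using y power_mono[OF y, of 2] by simp
  also have "\<dots> \<le> e\<^sup>2 * ((1 / (d * c)) powr (2 * a / kap) * A powr (2 * a / kap))"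
    using w by (simp add: power_mult_distrib mult_left_mono)
  finally have "A * y\<^sup>2 \<le> A * (e\<^sup>2 * ((1 / (d * c)) powr (2 * a / kap) * A powr (2 * a / kap)))"
    using assms by (intro mult_left_mono)
  also have "\<dots> = e\<^sup>2 * (1 / (d * c)) powr (2 * a / kap) * A powr (1 + 2 * a / kap)"
    using assms by (simp add: powr_add)
  finally show ?thesis using assms(2,7) by (simp add: add_increasing)
qed

section \<open>Decay at scale R, and vanishing of u\<close>

context test_function
begin

text \<open>Pointwise absorption leaves a multiple of R^(-2 \<gamma>) on the ball of radius R, whose
  volume contributes R^N. Integrability is part of the conclusion because the integral of a
  non-integrable function is 0 by default, so the bound alone would carry no information.\<close>

lemma weighted_integral_decay:
  fixes u :: "real ^ 'n::finite \<Rightarrow> real"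
  assumes sol: "solution f u" and stab: "stable f u" and bdd: "bounded (range u)"
  defines "\<gamma> \<equiv> 1 + 2 * (1 + b) / kap"
  obtains m D where "\<And>R. R > 0 \<Longrightarrow>
    (\<integral>x. f' (u x) * (\<phi> (u x))\<^sup>2 * (bump m R x)\<^sup>2 \<partial>lborel) \<le> D * R powr (real CARD('n) - 2 * \<gamma>)"
    and "\<And>R. R > 0 \<Longrightarrow> integrable lborel (\<lambda>x. f' (u x) * (\<phi> (u x))\<^sup>2 * (bump m R x)\<^sup>2)"
proof -
  obtain M where M: "M > 0" "\<And>x. \<bar>u x\<bar> \<le> M"
    using bdd unfolding bounded_pos by (metis rangeI real_norm_def)
  obtain d where d: "0 < d" "d < 1" and f\<psi>: "\<And>t. \<bar>t\<bar> \<le> M \<Longrightarrow> f t * \<psi> t \<le> (1 - d) * (f' t * (\<phi> t)\<^sup>2)"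
    by (rule f_\<psi>_le[OF M(1)]) blast
  obtain c where c: "c > 0" and f'c: "\<And>t. \<bar>t\<bar> \<le> M \<Longrightarrow> f' t \<ge> c * \<bar>f t\<bar> powr kap"
    by (rule f'_ge_power[OF M(1)]) blast
  have kap: "kap > 0" using lam lam_kap by simp
  obtain m where m: "\<gamma> \<le> real m" using real_arch_simple by blast
  \<comment> \<open>Being at least 2, k makes the bump C^1. Being at least \<gamma>, it leaves a
    nonnegative power of the base y when y^(2 k) meets the factor y^(-2 \<gamma>) of
    \<open>A powr \<gamma>\<close>.\<close>
  define k where "k = Suc (Suc m)"
  define Q where "Q = (32 / d + 1) * (2 * real k)\<^sup>2"
  have Q: "Q > 0" using d by (simp add: Q_def k_def add_pos_pos)
  define D where "D = ((2 / f t0) powr b)\<^sup>2 * (1 / (d / 4 * c)) powr (2 * (1 + b) / kap) * Q powr \<gamma>"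
  have D: "D \<ge> 0" by (simp add: D_def)
  have \<gamma>: "\<gamma> > 0" using b kap by (simp add: \<gamma>_def add_pos_nonneg)
  define V where "V = unit_ball_vol (real CARD('n))"
  have cu: "continuous_on UNIV u"
    by (rule C1_continuous) (use sol in \<open>simp add: solution_def C2_def\<close>)
  have comp: "continuous_on UNIV (\<lambda>x. g (u x))" if "\<And>t. isCont g t" for g :: "real \<Rightarrow> real"
    by (rule continuous_on_compose2[OF _ cu, of UNIV]) (use that in \<open>auto intro: continuous_at_imp_continuous_on\<close>)
  have c\<phi>: "continuous_on UNIV (\<lambda>x. \<phi> (u x))"
    by (rule comp) (rule DERIV_isCont[OF \<phi>_has_derivative])
  have cf': "continuous_on UNIV (\<lambda>x. f' (u x))"
    by (rule comp) (rule isCont_f')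
  have int1: "integrable lborel (\<lambda>x. f' (u x) * (\<phi> (u x))\<^sup>2 * (bump k R x)\<^sup>2)" if R: "R > 0" for R
  proof (rule integrable_continuous_compact_support[where R = R])
    show "continuous_on UNIV (\<lambda>x. f' (u x) * (\<phi> (u x))\<^sup>2 * (bump k R x)\<^sup>2)"
      by (intro continuous_intros c\<phi> cf' continuous_on_bump)
    show "f' (u x) * (\<phi> (u x))\<^sup>2 * (bump k R x)\<^sup>2 = 0" if "x \<notin> cball 0 R" for x
      using bump_outside[OF that R] by (simp add: k_def)
  qed
  have "(\<integral>x. f' (u x) * (\<phi> (u x))\<^sup>2 * (bump k R x)\<^sup>2 \<partial>lborel) \<le> 4 / d * D * V * R powr (real CARD('n) - 2 * \<gamma>)"
    if R: "R > 0" for R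
  proof -
    let ?z = "bump_gradient k R :: real ^ 'n \<Rightarrow> real ^ 'n"
    have z0: "?z x = 0" if "x \<notin> cball 0 R" for x
      using bump_outside[OF that R, of m] by (simp add: bump_gradient_def k_def)
    have energy: "(\<integral>x. d / 2 * (f' (u x) * (\<phi> (u x))\<^sup>2 * (bump k R x)\<^sup>2) \<partial>lborel)
      \<le> (\<integral>x. (32 / d + 1) * ((\<phi> (u x))\<^sup>2 * (norm (?z x))\<^sup>2) \<partial>lborel)"
    proof (rule stable_solution_energy_estimate[OF sol stab cont _ \<phi>_has_derivative _ \<phi>'_nonneg
          \<psi>_has_derivative \<psi>_abs_le d _ f'_nonneg])
      show "continuous_on UNIV f'" "continuous_on UNIV \<phi>'"
        using isCont_f' isCont_\<phi>' by (auto intro: continuous_at_imp_continuous_on)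
      show "f (u x) * \<psi> (u x) \<le> (1 - d) * (f' (u x) * (\<phi> (u x))\<^sup>2)" for x
        using M(2) by (rule f\<psi>)
      show "(bump k R has_derivative (\<lambda>h. ?z x \<bullet> h)) (at x)" for x
        unfolding k_def by (rule bump_has_derivative)
      show "continuous_on UNIV ?z" by (rule continuous_on_bump_gradient)
      show "bump k R x = 0" if "x \<notin> cball 0 R" for x :: "real ^ 'n"
        unfolding k_def using that R by (rule bump_outside)
    qed (rule z0)
    \<comment> \<open>The coefficient d / 4 is half of the d / 2 in \<open>energy\<close>; the other
      half remains on the left after absorption.\<close>
    have pointwise: "(32 / d + 1) * ((\<phi> (u x))\<^sup>2 * (norm (?z x))\<^sup>2)
      \<le> d / 4 * (f' (u x) * (\<phi> (u x))\<^sup>2 * (bump k R x)\<^sup>2) + indicator (cball 0 R) x * (D * R powr (- 2 * \<gamma>))" for x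
    proof -
      define y where "y = max 0 (1 - x \<bullet> x / R\<^sup>2)"
      have bk: "bump j R x = y ^ j" for j by (simp add: bump_def y_def)
      have y: "0 \<le> y" "y \<le> 1" by (auto simp: y_def)
      show ?thesis
      proof (cases "y = 0")
        case True
        then have "?z x = 0" by (simp add: bump_gradient_def bk k_def)
        then show ?thesis using f'_nonneg d D by (auto simp: indicator_def)
      next
        case False
        with y have y0: "y > 0" by simp
        have x: "x \<in> cball 0 R"
          using bump_outside[of x R 0] R y0 by (auto simp: bk)
        \<comment> \<open>Chosen so that (32 / d + 1) |grad \<zeta>|^2 <= A \<zeta>^2 for the bump
          \<zeta>; the y^(-2) is the power lost by the gradient.\<close>
        define A where "A = Q / (R\<^sup>2 * y\<^sup>2)"
        have A: "A \<ge> 0" using Q by (simp add: A_def)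
        have "norm (?z x) \<le> 2 * real k / R * y ^ Suc m"
          using norm_bump_gradient_le[OF R, of m x] by (simp add: k_def bk)
        then have "(norm (?z x))\<^sup>2 \<le> (2 * real k / R * y ^ Suc m)\<^sup>2" by (intro power_mono) auto
        then have "(32 / d + 1) * (norm (?z x))\<^sup>2 \<le> (32 / d + 1) * (2 * real k / R * y ^ Suc m)\<^sup>2"
          using d by (intro mult_left_mono) auto
        also have "\<dots> = Q / R\<^sup>2 * (y ^ Suc m)\<^sup>2"
          by (simp add: Q_def power_mult_distrib power_divide)
        also have "\<dots> = A * (y ^ k)\<^sup>2"
          using y0 by (simp add: A_def k_def power2_eq_square field_simps)
        finally have "(32 / d + 1) * (norm (?z x))\<^sup>2 * (\<phi> (u x))\<^sup>2 \<le> A * (y ^ k)\<^sup>2 * (\<phi> (u x))\<^sup>2"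
          by (rule mult_right_mono) simp
        also have "\<dots> = (y ^ k)\<^sup>2 * (A * (\<phi> (u x))\<^sup>2)" by simp
        also have "\<dots> \<le> (y ^ k)\<^sup>2 * (d / 4 * f' (u x) * (\<phi> (u x))\<^sup>2 + ((2 / f t0) powr b)\<^sup>2
            * (1 / (d / 4 * c)) powr (2 * (1 + b) / kap) * A powr (1 + 2 * (1 + b) / kap))"
          using d c kap b A f'_nonneg f'c[OF M(2)] \<phi>_bound
          by (intro mult_left_mono absorb_into_power[where w = "\<bar>f (u x)\<bar>"]) auto
        also have "\<dots> = d / 4 * (f' (u x) * (\<phi> (u x))\<^sup>2 * (bump k R x)\<^sup>2) + ((2 / f t0) powr b)\<^sup>2
            * (1 / (d / 4 * c)) powr (2 * (1 + b) / kap) * ((y ^ k)\<^sup>2 * A powr \<gamma>)"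
          by (simp add: \<gamma>_def bk algebra_simps)
        also have "\<dots> \<le> d / 4 * (f' (u x) * (\<phi> (u x))\<^sup>2 * (bump k R x)\<^sup>2) + ((2 / f t0) powr b)\<^sup>2
            * (1 / (d / 4 * c)) powr (2 * (1 + b) / kap) * (Q powr \<gamma> * R powr (- 2 * \<gamma>))"
        proof (intro add_left_mono mult_left_mono)
          have "(y ^ k)\<^sup>2 = y powr (2 * real k)"
            using powr_realpow[OF y0, of "k * 2"] by (simp add: power_mult mult.commute)
          moreover have "A powr \<gamma> = Q powr \<gamma> * R powr (- 2 * \<gamma>) * y powr (- 2 * \<gamma>)"
          proof -
            have "A = Q * R powr (- 2) * y powr (- 2)"
              using R y0 by (simp add: A_def powr_minus powr_numeral field_simps)
            then show ?thesis
              using R y0 Q by (simp add: powr_mult powr_powr)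
          qed
          ultimately have "(y ^ k)\<^sup>2 * A powr \<gamma> = Q powr \<gamma> * R powr (- 2 * \<gamma>) * y powr (2 * real k - 2 * \<gamma>)"
            using y0 by (simp add: powr_diff powr_minus field_simps)
          also have "\<dots> \<le> Q powr \<gamma> * R powr (- 2 * \<gamma>) * 1"
            using y m y0 by (intro mult_left_mono powr_le1) (auto simp: k_def)
          finally show "(y ^ k)\<^sup>2 * A powr \<gamma> \<le> Q powr \<gamma> * R powr (- 2 * \<gamma>)" by simp
        qed auto
        finally show ?thesis using x by (simp add: D_def ac_simps)
      qed
    qed
    have ind: "integrable lborel (\<lambda>x :: real ^ 'n. indicator (cball 0 R) x * (D * R powr (- 2 * \<gamma>)))"
      by (auto intro!: integrable_mult_left emeasure_compact_finite)
    have int2: "integrable lborel (\<lambda>x. (32 / d + 1) * ((\<phi> (u x))\<^sup>2 * (norm (?z x))\<^sup>2))"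
      by (rule integrable_continuous_compact_support[where R = R])
        (auto intro!: continuous_intros c\<phi> continuous_on_bump_gradient simp: z0)
    have "(\<integral>x. (32 / d + 1) * ((\<phi> (u x))\<^sup>2 * (norm (?z x))\<^sup>2) \<partial>lborel)
      \<le> (\<integral>x. d / 4 * (f' (u x) * (\<phi> (u x))\<^sup>2 * (bump k R x)\<^sup>2) + indicator (cball 0 R) x * (D * R powr (- 2 * \<gamma>)) \<partial>lborel)"
      using int1[OF R] int2 ind pointwise by (intro integral_mono) auto
    also have "\<dots> = d / 4 * (\<integral>x. f' (u x) * (\<phi> (u x))\<^sup>2 * (bump k R x)\<^sup>2 \<partial>lborel) + measure lborel (cball 0 R :: (real ^ 'n) set) * (D * R powr (- 2 * \<gamma>))"
      using int1[OF R] ind by simp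
    also have "measure lborel (cball 0 R :: (real ^ 'n) set) = V * R powr real CARD('n)"
      using R by (simp add: content_cball V_def powr_realpow)
    finally have "(\<integral>x. (32 / d + 1) * ((\<phi> (u x))\<^sup>2 * (norm (?z x))\<^sup>2) \<partial>lborel)
      \<le> d / 4 * (\<integral>x. f' (u x) * (\<phi> (u x))\<^sup>2 * (bump k R x)\<^sup>2 \<partial>lborel)
        + V * R powr real CARD('n) * (D * R powr (- 2 * \<gamma>))" .
    moreover have "d / 2 * (\<integral>x. f' (u x) * (\<phi> (u x))\<^sup>2 * (bump k R x)\<^sup>2 \<partial>lborel)
      \<le> (\<integral>x. (32 / d + 1) * ((\<phi> (u x))\<^sup>2 * (norm (?z x))\<^sup>2) \<partial>lborel)"
      using energy by (simp only: integral_mult_right_zero)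
    ultimately have "d / 4 * (\<integral>x. f' (u x) * (\<phi> (u x))\<^sup>2 * (bump k R x)\<^sup>2 \<partial>lborel)
        \<le> V * R powr real CARD('n) * (D * R powr (- 2 * \<gamma>))"
      by linarith
    also have "\<dots> = D * V * (R powr real CARD('n) * R powr (- 2 * \<gamma>))"
      by (simp only: ac_simps)
    also have "R powr real CARD('n) * R powr (- 2 * \<gamma>) = R powr (real CARD('n) - 2 * \<gamma>)"
      by (simp add: powr_add[symmetric])
    finally show ?thesis using d by (simp add: field_simps)
  qed
  with int1 that show ?thesis by blast
qed

text \<open>If u x is nonzero, the density g is bounded below on a ball around x, so the weighted
  integrals stay above some \<delta> > 0 for large R. The hypothesis \<open>dim\<close> says N < 2
  \<gamma>, so their upper bound tends to 0.\<close>

lemma stable_solution_eq_0: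
  fixes u :: "real ^ 'n::finite \<Rightarrow> real"
  assumes sol: "solution f u" and stab: "stable f u" and bdd: "bounded (range u)"
    and dim: "real CARD('n) < 2 + 4 * (1 + b) / kap"
  shows "u x = 0"
proof (rule ccontr)
  assume ux: "u x \<noteq> 0"
  define \<gamma> where "\<gamma> = 1 + 2 * (1 + b) / kap"
  obtain m D where le: "\<And>R. R > 0 \<Longrightarrow>
      (\<integral>x. f' (u x) * (\<phi> (u x))\<^sup>2 * (bump m R x)\<^sup>2 \<partial>lborel) \<le> D * R powr (real CARD('n) - 2 * \<gamma>)"
    and int: "\<And>R. R > 0 \<Longrightarrow> integrable lborel (\<lambda>x. f' (u x) * (\<phi> (u x))\<^sup>2 * (bump m R x)\<^sup>2)"
    unfolding \<gamma>_def by (rule weighted_integral_decay[OF sol stab bdd]) blast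
  define g where "g x = f' (u x) * (\<phi> (u x))\<^sup>2" for x
  have g_nonneg: "g y \<ge> 0" for y using f'_nonneg by (simp add: g_def)
  have "f' (u x) > 0" using f'_pos[of "\<bar>u x\<bar>"] ux by (simp add: f'_abs)
  moreover have "f (u x) \<noteq> 0" using pos[of "\<bar>u x\<bar>"] ux abs_f[of "u x"] by auto
  ultimately have gx: "g x > 0" using \<mu>_pos[OF ux] by (simp add: g_def \<phi>_def)
  have "isCont g x"
  proof -
    have "C1 u" using sol by (simp add: solution_def C2_def)
    then have "isCont u x"
      using C1_continuous[of u] by (simp add: continuous_on_eq_continuous_at)
    from isCont_o2[OF this isCont_f'] isCont_o2[OF this DERIV_isCont[OF \<phi>_has_derivative]]
    show ?thesis unfolding g_def by (rule continuous_mult[OF _ continuous_power])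
  qed
  then have "\<forall>\<^sub>F y in at x. g y > g x / 2"
    using gx by (intro order_tendstoD(1)) (auto simp: isCont_def)
  then obtain r where r: "r > 0" "\<And>y. dist y x < r \<Longrightarrow> g y > g x / 2"
  proof -
    assume *: "\<And>r. 0 < r \<Longrightarrow> (\<And>y. dist y x < r \<Longrightarrow> g x / 2 < g y) \<Longrightarrow> thesis"
    obtain r where "r > 0" "\<And>y. y \<noteq> x \<Longrightarrow> dist y x < r \<Longrightarrow> g x / 2 < g y"
      using \<open>\<forall>\<^sub>F y in at x. g x / 2 < g y\<close> unfolding eventually_at by blast
    moreover have "g x / 2 < g x" using gx by simp
    ultimately show thesis using * by metis
  qed
  define \<delta> where "\<delta> = measure lborel (ball x r) * (g x / 2 * ((1 / 2) ^ m)\<^sup>2)"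
  have \<delta>: "\<delta> > 0"
    using content_ball_pos[OF r(1), of x] gx by (simp add: \<delta>_def)
  \<comment> \<open>For R >= R0 the ball around x lies within radius R / 2, where the base of the
    bump is at least 3/4.\<close>
  define R0 where "R0 = 2 * (norm x + r)"
  have R0: "R0 > 0" using r by (simp add: R0_def add_nonneg_pos)
  have lower: "\<delta> \<le> D * R powr (real CARD('n) - 2 * \<gamma>)" if R: "R \<ge> R0" for R
  proof -
    have "\<delta> = (\<integral>y. indicator (ball x r) y * (g x / 2 * ((1 / 2) ^ m)\<^sup>2) \<partial>lborel)"
      by (simp add: \<delta>_def)
    also have "\<dots> \<le> (\<integral>y. g y * (bump m R y)\<^sup>2 \<partial>lborel)"
    proof (rule integral_mono)
      show "integrable lborel (\<lambda>y. indicator (ball x r) y * (g x / 2 * ((1 / 2) ^ m)\<^sup>2))"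
        by (intro integrable_mult_left integrable_real_indicator emeasure_bounded_finite) auto
      show "integrable lborel (\<lambda>y. g y * (bump m R y)\<^sup>2)"
        using int[of R] R R0 by (simp add: g_def)
      show "indicator (ball x r) y * (g x / 2 * ((1 / 2) ^ m)\<^sup>2) \<le> g y * (bump m R y)\<^sup>2" for y
      proof (cases "y \<in> ball x r")
        case True
        have "norm y \<le> norm x + r"
          using True norm_triangle_ineq2[of y x] by (simp add: dist_norm norm_minus_commute)
        then have "norm y \<le> R / 2" using R by (simp add: R0_def)
        then have "(norm y)\<^sup>2 \<le> (R / 2)\<^sup>2" by (intro power_mono) auto
        then have "y \<bullet> y \<le> R\<^sup>2 / 4"
          unfolding power2_norm_eq_inner by (simp add: power_divide)
        then have "y \<bullet> y / R\<^sup>2 \<le> 1 / 4"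
          using R R0 by (simp add: field_simps)
        then have "1 / 2 \<le> max 0 (1 - y \<bullet> y / R\<^sup>2)" by linarith
        then have "(1 / 2) ^ m \<le> bump m R y"
          unfolding bump_def by (rule power_mono) simp
        then have "((1 / 2) ^ m)\<^sup>2 \<le> (bump m R y)\<^sup>2" by (intro power_mono) auto
        moreover have "g x / 2 \<le> g y" using r(2)[of y] True by (simp add: dist_commute)
        ultimately have "g x / 2 * ((1 / 2) ^ m)\<^sup>2 \<le> g y * (bump m R y)\<^sup>2"
          using gx by (intro mult_mono) auto
        then show ?thesis using True by simp
      qed (use g_nonneg in simp)
    qed
    also have "\<dots> \<le> D * R powr (real CARD('n) - 2 * \<gamma>)"
      using le[of R] R R0 by (simp add: g_def)
    finally show ?thesis .
  qed
  have "real CARD('n) - 2 * \<gamma> < 0" using dim by (simp add: \<gamma>_def)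
  then have "((\<lambda>R. D * R powr (real CARD('n) - 2 * \<gamma>)) \<longlongrightarrow> D * 0) at_top"
    by (intro tendsto_mult tendsto_const tendsto_neg_powr filterlim_ident)
  then have "\<forall>\<^sub>F R in at_top. D * R powr (real CARD('n) - 2 * \<gamma>) < \<delta>"
    using \<delta> by (intro order_tendstoD(2)) auto
  moreover have "\<forall>\<^sub>F R in at_top. R \<ge> R0" by (rule eventually_ge_at_top)
  ultimately have "\<forall>\<^sub>F R :: real in at_top. False"
  proof eventually_elim
    case (elim R)
    then show ?case using lower[of R] by simp
  qed
  then show False by simp
qed

end

section \<open>The critical dimension\<close>

text \<open>In terms of s, numerator and denominator share the factor (s - 1) (s + 3). What remains
  is the conjugate exponent of (s - 1)^2 / 4.\<close>

lemma p_c_eq: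
  assumes "N \<ge> 11" and s: "s = sqrt (real N - 1)"
  shows "p_c N = (s - 1)\<^sup>2 / ((s + 1) * (s - 3))"
proof -
  have N: "real N = s\<^sup>2 + 1" using assms by simp
  have "s > 3" using assms real_less_rsqrt[of 3 "real N - 1"] by simp
  then have nz: "s - 1 \<noteq> 0" "s + 3 \<noteq> 0" "s + 1 \<noteq> 0" "s - 3 \<noteq> 0" by simp_all
  have num: "(real N - 2)\<^sup>2 - 4 * real N + 8 * s = (s - 1)\<^sup>2 * ((s - 1) * (s + 3))"
    unfolding N by (simp add: power2_eq_square algebra_simps)
  have den: "(real N - 2) * (real N - 10) = (s + 1) * (s - 3) * ((s - 1) * (s + 3))"
    unfolding N by (simp add: power2_eq_square algebra_simps)
  show ?thesis
    unfolding p_c_def s[symmetric] num den using nz by simp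
qed

text \<open>Conjugation reverses order, so p0 < p_c means r > (s - 1)^2 / 4, that is s < 1 + 2 sqrt
  r. Squaring gives the bound on N = s^2 + 1.\<close>

lemma subcritical_imp_dimension_lt:
  assumes N: "N \<ge> 11" and r: "1 < r" and p: "r / (r - 1) < p_c N"
  shows "real N < 2 + 4 * (r + sqrt r)"
proof -
  define s where "s = sqrt (real N - 1)"
  have s3: "s > 3" using N real_less_rsqrt[of 3 "real N - 1"] by (simp add: s_def)
  have "r > (s - 1)\<^sup>2 / 4"
  proof (rule ccontr)
    assume "\<not> r > (s - 1)\<^sup>2 / 4"
    then have le: "4 * r \<le> (s - 1)\<^sup>2" by simp
    have "(s - 1)\<^sup>2 * (r - 1) \<le> r * ((s + 1) * (s - 3))"
      using le by (simp add: power2_eq_square algebra_simps)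
    then have "p_c N \<le> r / (r - 1)"
      unfolding p_c_eq[OF N s_def] using s3 r by (simp add: divide_le_eq le_divide_eq mult.commute)
    with p show False by simp
  qed
  then have "((s - 1) / 2)\<^sup>2 < r" by (simp add: power_divide)
  then have "(s - 1) / 2 < sqrt r" by (rule real_less_rsqrt)
  then have "s < 2 * sqrt r + 1" by simp
  then have "s\<^sup>2 < (2 * sqrt r + 1)\<^sup>2" using s3 by (intro power_strict_mono) auto
  moreover have "s\<^sup>2 = real N - 1" using N by (simp add: s_def)
  moreover have "(2 * sqrt r + 1)\<^sup>2 = 4 * r + 4 * sqrt r + 1"
    using r by (simp add: power2_sum power_mult_distrib)
  ultimately show ?thesis by simp
qed

text \<open>A finite q0 < 1 has conjugate 1 + 1 / (q0 - 1) < 1, and q0 = \<infinity> has conjugate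
  1. For q0 = -\<infinity> the quotient evaluates to -\<infinity> times 0, which is 0 in
  \<open>ereal\<close>.\<close>

lemma conjugate_exponent_gt_1:
  assumes "1 < conjugate_exponent q0"
  obtains r where "q0 = ereal r" "1 \<le> r"
    "conjugate_exponent q0 = (if r = 1 then \<infinity> else ereal (r / (r - 1)))"
proof (cases q0)
  case (real r)
  then have eq: "conjugate_exponent q0 = (if r = 1 then \<infinity> else ereal (r / (r - 1)))"
    by (simp add: conjugate_exponent_def one_ereal_def)
  then have "1 \<le> r" using assms by (auto simp: one_ereal_def less_divide_eq split: if_splits)
  with real eq that show ?thesis by blast
qed (use assms in \<open>auto simp: conjugate_exponent_def divide_ereal_def minus_ereal_def one_ereal_def\<close>)

text \<open>Since r >= 1, the bound 2 + 4 (r + sqrt r) is at least 10, which settles N <= 9. It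
  exceeds 10 exactly when r > 1, that is when p0 is finite, which settles N = 10.\<close>

lemma dimension_condition:
  assumes dim: "(1 \<le> N \<and> N \<le> 9 \<and> 1 < p0)
       \<or> (N = 10 \<and> 1 < p0 \<and> p0 < \<infinity>)
       \<or> (N \<ge> 11 \<and> 1 < p0 \<and> p0 < ereal (p_c N))"
    and p0: "p0 = conjugate_exponent q0"
  obtains r where "q0 = ereal r" "1 \<le> r" "real N < 2 + 4 * (r + sqrt r)"
proof -
  have "1 < p0" using dim by blast
  then obtain r where r: "q0 = ereal r" "1 \<le> r" "p0 = (if r = 1 then \<infinity> else ereal (r / (r - 1)))"
    unfolding p0 by (rule conjugate_exponent_gt_1)
  have sqrt: "1 \<le> sqrt r" using r(2) by simp
  have "real N < 2 + 4 * (r + sqrt r)"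
    using dim
  proof (elim disjE conjE)
    assume "N \<le> 9"
    then have "real N \<le> 9" by simp
    moreover have "8 \<le> 4 * (r + sqrt r)" using add_mono[OF r(2) sqrt] by simp
    ultimately show ?thesis by linarith
  next
    assume "N = 10" "p0 < \<infinity>"
    then have "1 < r" using r by (auto split: if_splits)
    then have "8 < 4 * (r + sqrt r)" using add_less_le_mono[OF _ sqrt] by fastforce
    then show ?thesis using \<open>N = 10\<close> by simp
  next
    assume "N \<ge> 11" "p0 < ereal (p_c N)"
    then show ?thesis
      using r by (intro subcritical_imp_dimension_lt) (auto split: if_splits)
  qed
  with r that show ?thesis by blast
qed

text \<open>With x = 1 / sqrt r, the limiting choice b = x, kap = x^2 gives exactly r + sqrt r = (1
  + x) / x^2. The dimension bound is strict, so by continuity it survives b = x - e, kap = x^2 + e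
  for small e > 0; lam is then the midpoint of b^2 and x^2.\<close>

lemma exponents_exist:
  assumes r: "1 \<le> r" and dim: "d < 2 + 4 * (r + sqrt r)"
  obtains b lam kap where "0 < b" "b \<le> 1" "b\<^sup>2 < lam" "lam < 1 / r" "1 / r < kap"
    "d < 2 + 4 * (1 + b) / kap"
proof -
  define x where "x = 1 / sqrt r"
  have x: "0 < x" "x \<le> 1" and x2: "x\<^sup>2 = 1 / r"
    using r by (simp_all add: x_def power_divide)
  have "r = 1 / x\<^sup>2" "sqrt r = x / x\<^sup>2"
    using r x2 x by (simp_all add: x_def power2_eq_square real_div_sqrt)
  then have "r + sqrt r = (1 + x) / x\<^sup>2" by (simp add: add_divide_distrib)
  then have dim': "d < 2 + 4 * (1 + (x - 0)) / (x\<^sup>2 + 0)" using dim by simp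
  have "((\<lambda>e. 2 + 4 * (1 + (x - e)) / (x\<^sup>2 + e)) \<longlongrightarrow> 2 + 4 * (1 + (x - 0)) / (x\<^sup>2 + 0)) (at_right 0)"
    using x by (intro tendsto_intros) auto
  from order_tendstoD(1)[OF this dim']
  have "\<forall>\<^sub>F e in at_right 0. d < 2 + 4 * (1 + (x - e)) / (x\<^sup>2 + e)" .
  moreover have "\<forall>\<^sub>F e in at_right 0. e \<in> {0<..<x}"
    using x(1) by (rule eventually_at_right_real)
  ultimately have "\<forall>\<^sub>F e in at_right 0. d < 2 + 4 * (1 + (x - e)) / (x\<^sup>2 + e) \<and> e \<in> {0<..<x}"
    by (rule eventually_conj)
  then obtain e where e: "d < 2 + 4 * (1 + (x - e)) / (x\<^sup>2 + e)" "0 < e" "e < x"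
    using eventually_happens'[OF trivial_limit_at_right_real] by auto
  have "(x - e)\<^sup>2 < x\<^sup>2" using e by (intro power_strict_mono) auto
  then show ?thesis
    using that[of "x - e" "((x - e)\<^sup>2 + x\<^sup>2) / 2" "x\<^sup>2 + e"] e x unfolding x2[symmetric] by simp
qed

theorem corollary1p8:
  fixes f :: "real \<Rightarrow> real" and u :: "real ^ 'n::finite \<Rightarrow> real" and q0 p0 :: ereal
  assumes "continuous_on UNIV f"
    and "C2_pos f"
    and "mono f"
    and "\<And>t. f (- t) = - f t"
    and "convex_on {0<..} f"
    and "\<And>t. t > 0 \<Longrightarrow> f t > 0"
    and "(q f \<longlongrightarrow> q0) (at_right 0)"
    and "p0 = conjugate_exponent q0"
    and "solution f u"
    and "bounded (range u)"
    and "stable f u"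
    and "(1 \<le> CARD('n) \<and> CARD('n) \<le> 9 \<and> 1 < p0)
       \<or> (CARD('n) = 10 \<and> 1 < p0 \<and> p0 < \<infinity>)
       \<or> (CARD('n) \<ge> 11 \<and> 1 < p0 \<and> p0 < ereal (p_c CARD('n)))"
  shows "\<forall>x. u x = 0"
proof -
  interpret odd_convex_nonlinearity f
    by unfold_locales (use assms in auto)
  obtain r where r: "q0 = ereal r" "1 \<le> r" and dim: "real CARD('n) < 2 + 4 * (r + sqrt r)"
    using assms(12,8) by (rule dimension_condition)
  obtain b lam kap where b: "0 < b" "b \<le> 1" "b\<^sup>2 < lam" and lam: "lam < 1 / r" and kap: "1 / r < kap"
    and dim': "real CARD('n) < 2 + 4 * (1 + b) / kap"
    using r(2) dim by (rule exponents_exist)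
  have lam0: "0 < lam" using b(3) by (smt (verit) zero_le_power2)
  have kap0: "0 < kap" using lam0 lam kap by linarith
  have "ereal (1 / kap) < q0" "q0 < ereal (1 / lam)"
    using r lam kap lam0 kap0 by (simp_all add: field_simps)
  then have "\<forall>\<^sub>F t in at_right 0. ereal (1 / kap) < q f t" "\<forall>\<^sub>F t in at_right 0. q f t < ereal (1 / lam)"
    using order_tendstoD[OF assms(7)] by blast+
  then have "\<forall>\<^sub>F t in at_right 0. ereal (1 / kap) < q f t \<and> q f t < ereal (1 / lam)"
    by (rule eventually_conj)
  then obtain t1 where t1: "t1 > 0"
    "\<And>t. 0 < t \<Longrightarrow> t < t1 \<Longrightarrow> ereal (1 / kap) < q f t \<and> q f t < ereal (1 / lam)"
    unfolding eventually_at_right_field by blast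
  \<comment> \<open>Halving t1 gives a closed range of t, as the locale requires.\<close>
  have bounds: "lam * (f' t)\<^sup>2 \<le> f t * f'' t \<and> f t * f'' t \<le> kap * (f' t)\<^sup>2" if t: "0 < t" "t \<le> t1 / 2" for t
  proof -
    have qt: "ereal (1 / kap) < q f t" "q f t < ereal (1 / lam)" using t1(2)[of t] t t1(1) by auto
    \<comment> \<open>The upper bound on \<open>q f t\<close> excludes the default value \<infinity>
      in its definition.\<close>
    then have nz: "f t * f'' t \<noteq> 0" by (auto simp: q_def split: if_splits)
    then have "f t * f'' t > 0" using pos[OF t(1)] f''_nonneg[OF t(1)] by (simp add: zero_less_mult_iff)
    moreover have "1 / kap < (f' t)\<^sup>2 / (f t * f'' t)" "(f' t)\<^sup>2 / (f t * f'' t) < 1 / lam"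
      using qt nz by (simp_all add: q_def)
    ultimately show ?thesis using lam0 kap0 by (simp add: field_simps)
  qed
  interpret test_function f lam kap "t1 / 2" b
    by unfold_locales (use b lam0 lam kap t1(1) bounds in auto)
  show ?thesis
    using stable_solution_eq_0[OF assms(9,11,10) dim'] by blast
qed

end
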